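(* Let $\mathbb{F}$ be a field. The polynomial $p(\mathbf{x})=(x_{11}+\cdots+x_{17})(x_{21}+\cdots+x_{27})+(x_{31}+\cdots+x_{37})(x_{41}+\cdots+x_{47})$ is computable by a width-2 general ABP over $\mathbb{F}$, but is not computable by any width-2 weak ABP over $\mathbb{F}$.
   Context: An algebraic branching program (ABP) over $\mathbb{F}$ is a DAG with source $s$ and sink $t$, vertices assigned to layers, edges going from layer $i$ to layer $i+1$ and labelled by affine linear forms; width = max layer size, value = sum over $s$-$t$ paths of the products of edge labels. A weak ABP has edge labels of the form $\alpha x_i+\beta$ with $\alpha,\beta\in\mathbb{F}$ (a single variable); a general ABP allows arbitrary affine linear forms $\sum_i\alpha_ix_i+\beta$. *)

theory Defs
  imports "HOL-Library.Poly_Mapping" "Graph_Theory.Pair_Digraph"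
begin

text \<open>
  Formal multivariate polynomials as finitely supported maps from monomials (themselves finitely
  supported exponent maps) to coefficients; multiplication is the convolution product of
  \<^theory>\<open>HOL-Library.Poly_Mapping\<close>.  Equality is equality of formal polynomials,
  not of polynomial functions, which matters over finite fields.
\<close>

type_synonym ('v, 'a) mpoly = "('v \<Rightarrow>\<^sub>0 nat) \<Rightarrow>\<^sub>0 'a"

definition Const :: "'a \<Rightarrow> ('v, 'a::comm_semiring_1) mpoly" where
  "Const c = Poly_Mapping.single 0 c"

definition Var :: "'v \<Rightarrow> ('v, 'a::comm_semiring_1) mpoly" where
  "Var v = Poly_Mapping.single (Poly_Mapping.single v 1) 1"

text \<open>The set \<open>V\<close> of variables is meant to be finite.\<close>

definition affine_linear_form :: "'v set \<Rightarrow> ('v, 'a::field) mpoly \<Rightarrow> bool" where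
  "affine_linear_form V f \<longleftrightarrow>
     (\<exists>\<alpha> \<beta>. f = (\<Sum>v\<in>V. Const (\<alpha> v) * Var v) + Const \<beta>)"

definition simple_affine_linear_form :: "'v set \<Rightarrow> ('v, 'a::field) mpoly \<Rightarrow> bool" where
  "simple_affine_linear_form V f \<longleftrightarrow>
     (\<exists>v\<in>V. \<exists>\<alpha> \<beta>. f = Const \<alpha> * Var v + Const \<beta>)"

record (overloaded) ('n, 'v, 'a) abp =
  graph :: "'n pair_pre_digraph"
  layer :: "'n \<Rightarrow> int"
  label :: "'n \<times> 'n \<Rightarrow> ('v, 'a) mpoly"
  source :: 'n
  sink :: 'n

text \<open>
  The underlying graph has no parallel edges: an edge is a pair of vertices.  (With parallel edges
  the weak and the general model would coincide.)  Neither the source nor the sink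
  has to be the only vertex of its layer.
\<close>

definition is_abp :: "('n, 'v, 'a::field) abp \<Rightarrow> bool" where
  "is_abp A \<longleftrightarrow>
     pair_fin_digraph (graph A) \<and> acyclic (parcs (graph A)) \<and>
     source A \<in> pverts (graph A) \<and> sink A \<in> pverts (graph A) \<and>
     (\<forall>(u, v) \<in> parcs (graph A). layer A v = layer A u + 1)"

definition general_abp :: "'v set \<Rightarrow> ('n, 'v, 'a::field) abp \<Rightarrow> bool" where
  "general_abp V A \<longleftrightarrow>
     is_abp A \<and> (\<forall>e \<in> parcs (graph A). affine_linear_form V (label A e))"

definition weak_abp :: "'v set \<Rightarrow> ('n, 'v, 'a::field) abp \<Rightarrow> bool" where
  "weak_abp V A \<longleftrightarrow>
     is_abp A \<and> (\<forall>e \<in> parcs (graph A). simple_affine_linear_form V (label A e))"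

definition abp_width :: "('n, 'v, 'a::field) abp \<Rightarrow> nat" where
  "abp_width A =
     Max ((\<lambda>i. card {v \<in> pverts (graph A). layer A v = i}) ` layer A ` pverts (graph A))"

definition abp_value :: "('n, 'v, 'a::field) abp \<Rightarrow> ('v, 'a) mpoly" where
  "abp_value A =
     (\<Sum>p | pre_digraph.apath (with_proj (graph A)) (source A) p (sink A).
        prod_list (map (label A) p))"

text \<open>
  Vertex sets are finite, so natural numbers suffice as vertices.
\<close>

definition computable_general_abp :: "'v set \<Rightarrow> nat \<Rightarrow> ('v, 'a::field) mpoly \<Rightarrow> bool" where
  "computable_general_abp V w p \<longleftrightarrow>
     (\<exists>A :: (nat, 'v, 'a) abp. general_abp V A \<and> abp_width A = w \<and> abp_value A = p)"

definition computable_weak_abp :: "'v set \<Rightarrow> nat \<Rightarrow> ('v, 'a::field) mpoly \<Rightarrow> bool" where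
  "computable_weak_abp V w p \<longleftrightarrow>
     (\<exists>A :: (nat, 'v, 'a) abp. weak_abp V A \<and> abp_width A = w \<and> abp_value A = p)"

text \<open>The variable \<open>x\<^sub>i\<^sub>j\<close> is represented by the index pair \<open>(i, j)\<close>.\<close>

definition x_vars :: "(nat \<times> nat) set" where
  "x_vars = {1..4} \<times> {1..7}"

definition p_poly :: "(nat \<times> nat, 'a::field) mpoly" where
  "p_poly = (\<Sum>j=1..7. Var (1, j)) * (\<Sum>j=1..7. Var (2, j))
          + (\<Sum>j=1..7. Var (3, j)) * (\<Sum>j=1..7. Var (4, j))"

end

theory Submission
  imports Defs "HOL-Algebra.Algebraic_Closure_Type"
begin

text \<open>
  The diamond with four edges shows the upper bound.  For the lower bound, evaluate everything over
  an algebraic closure \<open>K\<close> of the field: a weak ABP of width two becomes a chain of \<open>2 \<times> 2\<close> matrices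
  whose entries are affine functions of a single variable.

  If all determinants are nonzero constants, each matrix is a constant matrix times a transvection
  whose parameter is a linear form.  After merging neighbouring transvections with parallel axes, the
  leading homogeneous part is a nonzero multiple of the product of the remaining linear forms, so a
  quadratic value depends on at most two linear forms, and \<open>p\<close> depends on more.

  If some determinant is not a nonzero constant, it has a zero.  Fixing the at most four variables of
  that matrix at a zero makes it a constant matrix of rank one, and the value splits as \<open>L * R\<close>.
  After fixing four variables \<open>p\<close> is still irreducible, so \<open>L\<close> or \<open>R\<close> is constant.  Consider the
  shortest suffix of the chain that still computes \<open>p\<close> after fixing at most four variables, and its
  first matrix \<open>M\<close> without nonzero constant determinant.  For \<open>M\<close> it must be \<open>R\<close> that is
  constant, since a constant \<open>L\<close> would yield a shorter suffix, so the part of the suffix before \<open>M\<close>, where all determinants are nonzero constants, computes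
  \<open>p\<close> after fixing at most \<open>4 + 4\<close> variables.  As \<open>8 < 14\<close>, at most one of the four sums loses all
  its variables, and the zero can be chosen such that this sum becomes a nonzero constant.
\<close>

section \<open>Functions that are polynomial along lines\<close>

definition line :: "('v \<Rightarrow> 'k::field) \<Rightarrow> ('v \<Rightarrow> 'k) \<Rightarrow> 'k \<Rightarrow> 'v \<Rightarrow> 'k" where
  "line x d t = (\<lambda>v. x v + t * d v)"

text \<open>Only restrictions to lines are ever inspected, so this stands in for multivariate
  polynomials over the closure while all arguments stay univariate.\<close>

definition polyfun :: "(('v \<Rightarrow> 'k::field) \<Rightarrow> 'k) \<Rightarrow> bool" where
  "polyfun f \<longleftrightarrow> (\<forall>x d. \<exists>q. \<forall>t. f (line x d t) = poly q t)"

text \<open>\<open>l\<close> is the linear part of \<open>f\<close>. In particular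
  \<open>affine_wrt l l\<close> says that \<open>l\<close> is a linear form, and it is used in this
  sense throughout.\<close>

definition affine_wrt :: "(('v \<Rightarrow> 'k::field) \<Rightarrow> 'k) \<Rightarrow> (('v \<Rightarrow> 'k) \<Rightarrow> 'k) \<Rightarrow> bool" where
  "affine_wrt f l \<longleftrightarrow> (\<forall>x d t. f (line x d t) = f x + t * l d)"

lemma line_0 [simp]: "line x d 0 = x"
  by (simp add: line_def)

lemma line_diff_1 [simp]: "line x (\<lambda>v. y v - x v) 1 = y"
  by (simp add: line_def)

lemma line_zero_1 [simp]: "line (\<lambda>_. 0) d 1 = d"
  by (simp add: line_def)

lemma line_line: "line (line x d r) e t = line (line x e t) d r"
  by (simp add: line_def algebra_simps)

lemma affine_wrtD: "affine_wrt f l \<Longrightarrow> f (line x d t) = f x + t * l d"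
  by (simp add: affine_wrt_def)

lemma affine_wrt_linear:
  assumes "affine_wrt f l"
  shows "affine_wrt l l" and "l (\<lambda>_. 0) = 0"
proof -
  have "l (line x d t) = l x + t * l d" for x d t
  proof -
    have "f (\<lambda>_. 0) + l (line x d t) = f (line (\<lambda>_. 0) (line x d t) 1)"
      using affine_wrtD[OF assms, of "\<lambda>_. 0" "line x d t" 1] by simp
    also have "\<dots> = f x + t * l d"
      using affine_wrtD[OF assms] by simp
    also have "f x = f (\<lambda>_. 0) + l x"
      using affine_wrtD[OF assms, of "\<lambda>_. 0" x 1] by simp
    finally show ?thesis by (simp add: algebra_simps)
  qed
  then show "affine_wrt l l" by (simp add: affine_wrt_def)
  show "l (\<lambda>_. 0) = 0"
    using affine_wrtD[OF assms, of "\<lambda>_. 0" "\<lambda>_. 0" 1] by simp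
qed

lemma affine_wrt_polyfun: "affine_wrt f l \<Longrightarrow> polyfun f"
  unfolding polyfun_def
proof (intro allI)
  fix x d assume "affine_wrt f l"
  then show "\<exists>q. \<forall>t. f (line x d t) = poly q t"
    by (intro exI[of _ "[:f x, l d:]"]) (simp add: affine_wrt_def)
qed

lemma affine_wrt_add:
  "affine_wrt f l \<Longrightarrow> affine_wrt g m \<Longrightarrow> affine_wrt (\<lambda>x. f x + g x) (\<lambda>x. l x + m x)"
  by (simp add: affine_wrt_def algebra_simps)

lemma affine_wrt_cmult: "affine_wrt f l \<Longrightarrow> affine_wrt (\<lambda>x. c * f x) (\<lambda>x. c * l x)"
  by (simp add: affine_wrt_def algebra_simps)

lemma affine_wrt_const: "affine_wrt (\<lambda>_. c) (\<lambda>_. 0)"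
  by (simp add: affine_wrt_def)

lemma affine_wrt_sum:
  "(\<And>i. i \<in> I \<Longrightarrow> affine_wrt (f i) (l i)) \<Longrightarrow> affine_wrt (\<lambda>x. \<Sum>i\<in>I. f i x) (\<lambda>x. \<Sum>i\<in>I. l i x)"
  by (induction I rule: infinite_finite_induct) (auto intro: affine_wrt_const affine_wrt_add)

lemma polyfun_const: "polyfun (\<lambda>_. c)"
  by (rule affine_wrt_polyfun[OF affine_wrt_const])

lemma polyfun_add: "polyfun f \<Longrightarrow> polyfun g \<Longrightarrow> polyfun (\<lambda>x. f x + g x)"
  unfolding polyfun_def by (metis poly_add)

lemma polyfun_diff: "polyfun f \<Longrightarrow> polyfun g \<Longrightarrow> polyfun (\<lambda>x. f x - g x)"
  unfolding polyfun_def by (metis poly_diff)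

lemma polyfun_mult: "polyfun f \<Longrightarrow> polyfun g \<Longrightarrow> polyfun (\<lambda>x. f x * g x)"
  unfolding polyfun_def by (metis poly_mult)

lemma polyfun_shift: "polyfun f \<Longrightarrow> polyfun (\<lambda>x. f (line x e r))"
  unfolding polyfun_def by (subst line_line) blast

section \<open>Polynomial functions over an algebraically closed field\<close>

lemma infinite_UNIV_alg_closed: "infinite (UNIV :: 'k::alg_closed_field set)"
proof
  assume fin: "finite (UNIV :: 'k set)"
  \<comment> \<open>For a finite field this polynomial would be nonconstant and yet take the value
    one everywhere.\<close>
  define p where "p = (\<Prod>a\<in>(UNIV :: 'k set). [:-a, 1:]) + 1"
  have "poly p x = 1" for x
    using fin by (auto simp: p_def poly_prod intro!: prod_zero)
  moreover have "degree p > 0"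
  proof -
    have "degree (\<Prod>a\<in>(UNIV :: 'k set). [:-a, 1:]) = card (UNIV :: 'k set)"
      by (subst degree_prod_eq_sum_degree) auto
    moreover have "card (UNIV :: 'k set) > 0" using fin by (simp add: finite_UNIV_card_ge_0)
    ultimately show ?thesis unfolding p_def
      by (subst degree_add_eq_left) auto
  qed
  ultimately show False using alg_closed_imp_poly_has_root[of p] by auto
qed

lemma poly_eqI_alg_closed:
  fixes p q :: "'k::alg_closed_field poly"
  assumes "\<And>t. poly p t = poly q t"
  shows "p = q"
proof (rule ccontr)
  assume "p \<noteq> q"
  then have "finite {t. poly (p - q) t = 0}" by (intro poly_roots_finite) simp
  moreover have "{t. poly (p - q) t = 0} = UNIV" using assms by simp
  ultimately show False using infinite_UNIV_alg_closed by metis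
qed

text \<open>On the line joining a point with \<open>f\<close> nonzero to a point with
  \<open>g\<close> nonzero, both restrict to nonzero univariate polynomials. The lemma also serves
  as a density argument: an identity checked where \<open>s 2\<close> is nonzero holds
  everywhere.\<close>

lemma polyfun_mult_eq_0:
  fixes f g :: "('v \<Rightarrow> 'k::alg_closed_field) \<Rightarrow> 'k"
  assumes "polyfun f" "polyfun g" "\<And>x. f x * g x = 0"
  shows "(\<forall>x. f x = 0) \<or> (\<forall>x. g x = 0)"
proof (rule ccontr)
  assume "\<not> ?thesis"
  then obtain a b where ab: "f a \<noteq> 0" "g b \<noteq> 0" by auto
  define d where "d = (\<lambda>v. b v - a v)"
  obtain p where p: "\<And>t. f (line a d t) = poly p t" using assms(1) unfolding polyfun_def by blast
  obtain q where q: "\<And>t. g (line a d t) = poly q t" using assms(2) unfolding polyfun_def by blast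
  have "p * q = 0"
    by (rule poly_eqI_alg_closed) (simp flip: p q add: assms(3))
  moreover have "p \<noteq> 0" using p[of 0] ab(1) by auto
  moreover have "q \<noteq> 0" using q[of 1] ab(2) by (auto simp: d_def)
  ultimately show False by simp
qed

lemma polyfun_no_zero_line:
  fixes f :: "('v \<Rightarrow> 'k::alg_closed_field) \<Rightarrow> 'k"
  assumes "polyfun f" "\<And>t. f (line x d t) \<noteq> 0"
  shows "f (line x d t) = f x"
proof -
  obtain p where p: "\<And>t. f (line x d t) = poly p t" using assms(1) unfolding polyfun_def by blast
  have "degree p = 0" using assms(2) p alg_closed_imp_poly_has_root[of p] by auto
  then show ?thesis using p[of t] p[of 0] by (auto elim: degree_eq_zeroE)
qed

lemma polyfun_no_zero_const:
  fixes f :: "('v \<Rightarrow> 'k::alg_closed_field) \<Rightarrow> 'k"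
  assumes "polyfun f" "\<And>x. f x \<noteq> 0"
  shows "f x = f y"
  using polyfun_no_zero_line[of f y "\<lambda>v. x v - y v" 1] assms by simp

text \<open>If the factor \<open>L\<close> does not depend on the variable of \<open>s 1\<close>, then it divides both \<open>s 2\<close> and
  \<open>s 3 * s 4\<close>, so its zero set has codimension two.  Hence \<open>L\<close> is constant along every line avoiding
  that set, and any two points off \<open>s 2 = 0\<close> are joined by such lines.\<close>
lemma factor_constant:
  fixes L R :: "('v \<Rightarrow> 'k::alg_closed_field) \<Rightarrow> 'k"
  assumes L: "polyfun L" and R: "polyfun R"
    and s: "\<And>i. i \<in> {1..4::nat} \<Longrightarrow> affine_wrt (s i) (l i)"
    and dir: "\<And>i k. i \<in> {1..4} \<Longrightarrow> k \<in> {1..4} \<Longrightarrow> l i (d k) = (if i = k then 1 else 0)"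
    and LR: "\<And>x. L x * R x = s 1 x * s 2 x + s 3 x * s 4 x"
    and L1: "\<And>x. L (line x (d 1) 1) = L x"
  shows "\<exists>c. \<forall>x. L x = c"
proof -
  have sd: "s i (line x (d k) t) = s i x + (if i = k then t else 0)"
    if "i \<in> {1..4}" "k \<in> {1..4}" for i k x t
    using affine_wrtD[OF s] that by (simp add: dir)
  have sa: "s i (line x (\<lambda>v. y v - x v) t) = s i x + t * (s i y - s i x)" if "i \<in> {1..4}" for i x y t
    using affine_wrtD[OF s[OF that], of x "\<lambda>v. y v - x v" t] 
      affine_wrtD[OF s[OF that], of x "\<lambda>v. y v - x v" 1] by simp
  have s2: "polyfun (s 2)" using affine_wrt_polyfun s[of 2] by auto
  have s2_nz: "\<exists>x. s 2 x \<noteq> 0"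
    using sd[of 2 2 "\<lambda>_. 0" "1 - s 2 (\<lambda>_. 0)"]
    by (intro exI[of _ "line (\<lambda>_. 0) (d 2) (1 - s 2 (\<lambda>_. 0))"]) simp
  have ind0: "L (line x (d 1) t) = L x" if "s 2 x \<noteq> 0" for x t
  proof -
    obtain p where p: "\<And>t. L (line x (d 1) t) = poly p t" using L unfolding polyfun_def by blast
    obtain q where q: "\<And>t. R (line x (d 1) t) = poly q t" using R unfolding polyfun_def by blast
    \<comment> \<open>The degree bound matters: in characteristic \<open>c\<close> the polynomial
      \<open>t^c - t\<close> is also invariant under the unit step of \<open>L1\<close>, but an
      invariant polynomial of degree at most one is constant.\<close>
    have "p * q = [:s 1 x * s 2 x + s 3 x * s 4 x, s 2 x:]"
      by (rule poly_eqI_alg_closed) (simp flip: p q add: LR sd algebra_simps)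
    then have "degree (p * q) = 1" "p * q \<noteq> 0" using that by auto
    then have "degree p \<le> 1" by (metis degree_mult_eq le_add1 mult_eq_0_iff)
    then have lin: "poly p r = coeff p 0 + coeff p 1 * r" for r
      by (cases "degree p") (auto simp: poly_altdef coeff_eq_0)
    have "coeff p 1 = 0" using p[of 0] p[of 1] L1[of x] by (simp add: lin)
    then show ?thesis using p[of t] p[of 0] by (simp add: lin)
  qed
  have ind: "L (line x (d 1) t) = L x" for x t
  proof -
    have "(\<forall>x. L (line x (d 1) t) - L x = 0) \<or> (\<forall>x. s 2 x = 0)"
      using ind0 by (intro polyfun_mult_eq_0[OF polyfun_diff[OF polyfun_shift[OF L] L] s2]) auto
    then show ?thesis using s2_nz by auto
  qed
  \<comment> \<open>A zero of \<open>L\<close> stays a zero when \<open>s 1\<close> grows by one;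
    subtracting the two equations leaves \<open>s 2 x = 0\<close>.\<close>
  have zero: "s 2 x = 0 \<and> s 3 x * s 4 x = 0" if "L x = 0" for x
  proof -
    have "s 1 x * s 2 x + s 3 x * s 4 x = 0" using LR[of x] that by simp
    moreover have "(s 1 x + 1) * s 2 x + s 3 x * s 4 x = 0"
      using LR[of "line x (d 1) 1"] that by (simp add: ind sd del: One_nat_def)
    ultimately show ?thesis by (simp add: algebra_simps)
  qed
  \<comment> \<open>On the line through \<open>x\<close> and \<open>y\<close> the value of
    \<open>s 2\<close> stays fixed and nonzero, so \<open>L\<close> has no zero there;
    \<open>eq34\<close> does the same with \<open>s 3\<close> and \<open>s 4\<close>.\<close>
  have eq2: "L x = L y" if "s 2 x \<noteq> 0" "s 2 x = s 2 y" for x y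
    using polyfun_no_zero_line[OF L, of x "\<lambda>v. y v - x v" 1] zero sa[of 2 x y] that by fastforce
  have eq34: "L x = L y" if "s 3 x = s 3 y" "s 4 x = s 4 y" "s 3 x * s 4 x \<noteq> 0" for x y
    using polyfun_no_zero_line[OF L, of x "\<lambda>v. y v - x v" 1] zero sa[of 3 x y] sa[of 4 x y] that
    by fastforce
  \<comment> \<open>\<open>u\<close> sets \<open>s 3\<close> and \<open>s 4\<close> to one and keeps
    \<open>s 2\<close>, so \<open>eq2\<close> leads from \<open>x\<close> to \<open>u x\<close> and
    \<open>eq34\<close> from \<open>u x\<close> to \<open>u y\<close>.\<close>
  define u where "u x = line (line x (d 3) (1 - s 3 x)) (d 4) (1 - s 4 x)" for x
  have u: "s 2 (u x) = s 2 x" "s 3 (u x) = 1" "s 4 (u x) = 1" for x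
    by (simp_all add: u_def sd)
  have eq: "L x = L y" if "s 2 x \<noteq> 0" "s 2 y \<noteq> 0" for x y
  proof -
    have "L x = L (u x)" by (rule eq2) (simp_all add: u that)
    also have "\<dots> = L (u y)" by (rule eq34) (simp_all add: u)
    also have "\<dots> = L y" by (rule eq2) (simp_all add: u that)
    finally show ?thesis .
  qed
  obtain z where z: "s 2 z \<noteq> 0" using s2_nz by blast
  have "(\<forall>x. L x - L z = 0) \<or> (\<forall>x. s 2 x = 0)"
  proof (rule polyfun_mult_eq_0[OF polyfun_diff[OF L polyfun_const] s2])
    show "(L x - L z) * s 2 x = 0" for x
      by (cases "s 2 x = 0") (simp_all add: eq[OF _ z])
  qed
  then show ?thesis using z by auto
qed

text \<open>In direction \<open>d 1\<close> the quadric has degree one wherever \<open>s 2\<close>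
  is nonzero, so at such a point one of the differences \<open>L'\<close>, \<open>R'\<close>
  vanishes. Polynomial functions have no zero divisors, hence one difference vanishes identically
  and \<open>factor_constant\<close> applies to that factor.\<close>

lemma quadric_irreducible:
  fixes L R :: "('v \<Rightarrow> 'k::alg_closed_field) \<Rightarrow> 'k"
  assumes L: "polyfun L" and R: "polyfun R"
    and s: "\<And>i. i \<in> {1..4::nat} \<Longrightarrow> affine_wrt (s i) (l i)"
    and dir: "\<And>i k. i \<in> {1..4} \<Longrightarrow> k \<in> {1..4} \<Longrightarrow> l i (d k) = (if i = k then 1 else 0)"
    and LR: "\<And>x. L x * R x = s 1 x * s 2 x + s 3 x * s 4 x"
  shows "(\<exists>c. \<forall>x. L x = c) \<or> (\<exists>c. \<forall>x. R x = c)"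
proof -
  have sd: "s i (line x (d k) t) = s i x + (if i = k then t else 0)"
    if "i \<in> {1..4}" "k \<in> {1..4}" for i k x t
    using affine_wrtD[OF s] that by (simp add: dir)
  have s2: "polyfun (s 2)" using affine_wrt_polyfun s[of 2] by auto
  have s2_nz: "\<exists>x. s 2 x \<noteq> 0"
    using sd[of 2 2 "\<lambda>_. 0" "1 - s 2 (\<lambda>_. 0)"]
    by (intro exI[of _ "line (\<lambda>_. 0) (d 2) (1 - s 2 (\<lambda>_. 0))"]) simp
  define L' where "L' x = L (line x (d 1) 1) - L x" for x
  define R' where "R' x = R (line x (d 1) 1) - R x" for x
  have pf: "polyfun L'" "polyfun R'"
    unfolding L'_def R'_def
    by (rule polyfun_diff[OF polyfun_shift[OF L] L], rule polyfun_diff[OF polyfun_shift[OF R] R])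
  have "L' x * R' x * s 2 x = 0" for x
  proof (cases "s 2 x = 0")
    case False
    obtain p where p: "\<And>t. L (line x (d 1) t) = poly p t" using L unfolding polyfun_def by blast
    obtain q where q: "\<And>t. R (line x (d 1) t) = poly q t" using R unfolding polyfun_def by blast
    have "p * q = [:s 1 x * s 2 x + s 3 x * s 4 x, s 2 x:]"
      by (rule poly_eqI_alg_closed) (simp flip: p q add: LR sd algebra_simps)
    then have "degree (p * q) = 1" "p * q \<noteq> 0" using False by auto
    then have "degree p = 0 \<or> degree q = 0" by (auto simp: degree_mult_eq)
    then show ?thesis using p[of 0] p[of 1] q[of 0] q[of 1]
      by (auto simp: L'_def R'_def elim!: degree_eq_zeroE)
  qed simp
  then have "(\<forall>x. L' x * R' x = 0) \<or> (\<forall>x. s 2 x = 0)"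
    by (rule polyfun_mult_eq_0[OF polyfun_mult[OF pf] s2])
  then have "\<And>x. L' x * R' x = 0" using s2_nz by blast
  then have "(\<forall>x. L' x = 0) \<or> (\<forall>x. R' x = 0)"
    by (rule polyfun_mult_eq_0[OF pf])
  then show ?thesis
  proof
    assume "\<forall>x. L' x = 0"
    then have "L (line x (d 1) 1) = L x" for x by (simp add: L'_def)
    then show ?thesis by (intro disjI1) (rule factor_constant[OF L R s dir LR])
  next
    assume "\<forall>x. R' x = 0"
    then have R1: "R (line x (d 1) 1) = R x" for x by (simp add: R'_def)
    have RL: "R x * L x = s 1 x * s 2 x + s 3 x * s 4 x" for x
      using LR[of x] by (simp add: mult.commute)
    show ?thesis by (intro disjI2) (rule factor_constant[OF R L s dir RL R1])
  qed
qed

section \<open>Chains of matrices with constant determinant\<close>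

type_synonym 'k vec2 = "'k \<times> 'k"
type_synonym 'k mat2 = "'k \<times> 'k \<times> 'k \<times> 'k"

text \<open>The determinant of the columns \<open>a\<close> and \<open>w\<close>. Every linear
  functional on the plane is \<open>cross2 h\<close> for some \<open>h\<close>, so \<open>h\<close>
  stands for a row vector.\<close>

definition cross2 :: "'k::field vec2 \<Rightarrow> 'k vec2 \<Rightarrow> 'k" where
  "cross2 a w = fst a * snd w - snd a * fst w"

definition transvection :: "'k::field vec2 \<Rightarrow> 'k \<Rightarrow> 'k vec2 \<Rightarrow> 'k vec2" where
  "transvection a s w = (fst w + s * cross2 a w * fst a, snd w + s * cross2 a w * snd a)"

fun mat_vec :: "'k::field mat2 \<Rightarrow> 'k vec2 \<Rightarrow> 'k vec2" where
  "mat_vec (a, b, c, d) (x, y) = (a * x + b * y, c * x + d * y)"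

fun det2 :: "'k::field mat2 \<Rightarrow> 'k" where
  "det2 (a, b, c, d) = a * d - b * c"

definition chain_apply :: "(('v \<Rightarrow> 'k) \<Rightarrow> 'k mat2) list \<Rightarrow> ('v \<Rightarrow> 'k::field) \<Rightarrow> 'k vec2 \<Rightarrow> 'k vec2" where
  "chain_apply Ms x w = foldr (\<lambda>M. mat_vec (M x)) Ms w"

definition word_apply ::
    "('k vec2 \<times> (('v \<Rightarrow> 'k) \<Rightarrow> 'k)) list \<Rightarrow> ('v \<Rightarrow> 'k::field) \<Rightarrow> 'k vec2 \<Rightarrow> 'k vec2" where
  "word_apply ts x w = foldr (\<lambda>(a, l). transvection a (l x)) ts w"

lemma chain_apply_simps [simp]:
  "chain_apply [] x w = w"
  "chain_apply (M # Ms) x w = mat_vec (M x) (chain_apply Ms x w)"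
  "chain_apply (Ms @ Ns) x w = chain_apply Ms x (chain_apply Ns x w)"
  by (simp_all add: chain_apply_def)

lemma word_apply_simps [simp]:
  "word_apply [] x w = w"
  "word_apply ((a, l) # ts) x w = transvection a (l x) (word_apply ts x w)"
  by (simp_all add: word_apply_def)

text \<open>\<open>A\<close> multiplies \<open>cross2\<close> by \<open>det2 A\<close>, so
  conjugation by \<open>A\<close> moves the axis and divides the parameter by the determinant. This
  lets constant matrices be pushed to the right end of a chain.\<close>

lemma mat_vec_transvection:
  assumes "det2 A \<noteq> 0"
  shows "mat_vec A (transvection a s w) = transvection (mat_vec A a) (s / det2 A) (mat_vec A w)"
proof -
  obtain p q r u where A: "A = (p, q, r, u)" by (cases A)
  obtain a1 a2 where a: "a = (a1, a2)" by (cases a)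
  obtain w1 w2 where w: "w = (w1, w2)" by (cases w)
  have "cross2 (mat_vec A a) (mat_vec A w) = det2 A * cross2 a w"
    by (simp add: A a w cross2_def algebra_simps)
  then have "s / det2 A * cross2 (mat_vec A a) (mat_vec A w) = s * cross2 a w"
    using assms by simp
  then show ?thesis
    unfolding transvection_def by (simp add: A a w algebra_simps)
qed

lemma cross2_transvection_parallel: "cross2 b a = 0 \<Longrightarrow> cross2 b (transvection a s w) = cross2 b w"
proof -
  assume "cross2 b a = 0"
  moreover have "cross2 b (transvection a s w) = cross2 b w + s * cross2 a w * cross2 b a"
    by (simp add: cross2_def transvection_def algebra_simps)
  ultimately show ?thesis by simp
qed

section \<open>From matrices of constant determinant to transvections\<close>

lemma traceless_nilpotent_proportional:
  fixes p q r p0 q0 r0 :: "'k::field"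
  assumes "p0\<^sup>2 + q0 * r0 = 0" "q0 \<noteq> 0" 
    and "\<And>s t. (s * p + t * p0)\<^sup>2 + (s * q + t * q0) * (s * r + t * r0) = 0"
  shows "p = q / q0 * p0 \<and> r = q / q0 * r0"
proof -
  \<comment> \<open>These coefficients cancel the \<open>q\<close> entry of the combination, so its
    \<open>p\<close> entry squares to zero. Adding the second matrix once more then isolates the
    \<open>r\<close> entry \<open>e\<close>; this works in every characteristic.\<close>
  have "(q0 * p - q * p0)\<^sup>2 = 0"
    using assms(3)[of q0 "- q"] by (simp add: algebra_simps)
  then have p: "q0 * p = q * p0" by simp
  define e where "e = q0 * r - q * r0"
  have "((q0 * p - q * p0) + p0)\<^sup>2 + q0 * (e + r0) = 0"
    using assms(3)[of q0 "1 - q"] by (simp add: e_def algebra_simps)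
  then have "q0 * e = 0"
    using assms(1) p by (simp add: distrib_left add.left_commute)
  then have "q0 * r = q * r0" using assms(2) by (simp add: e_def)
  with p show ?thesis using assms(2) by (simp add: field_simps)
qed

text \<open>The matrices \<open>C x = (p, q; r, -p)\<close> of vanishing determinant form a linear space, and a linear
  space of nilpotent \<open>2 \<times> 2\<close> matrices is at most one-dimensional (in every characteristic).\<close>
lemma nilpotent_space:
  fixes p q r :: "('v \<Rightarrow> 'k::field) \<Rightarrow> 'k"
  assumes lin: "affine_wrt p p" "affine_wrt q q" "affine_wrt r r"
    and nil: "\<And>x. (p x)\<^sup>2 + q x * r x = 0"
  shows "\<exists>a l. affine_wrt l l \<and>
    (\<forall>x w. (fst w + (p x * fst w + q x * snd w), snd w + (r x * fst w - p x * snd w)) =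
      transvection a (l x) w)"
proof -
  have comb: "(s * p x + t * p z)\<^sup>2 + (s * q x + t * q z) * (s * r x + t * r z) = 0" for s t x z
  proof -
    have scale: "f (\<lambda>v. s * x v + t * z v) = s * f x + t * f z" if "affine_wrt f f" for f
    proof -
      have "line (line (\<lambda>_. 0) x s) z t = (\<lambda>v. s * x v + t * z v)" by (simp add: line_def)
      then show ?thesis
        using affine_wrtD[OF that, of "line (\<lambda>_. 0) x s" z t] affine_wrtD[OF that, of "\<lambda>_. 0" x s]
          affine_wrt_linear(2)[OF that] by simp
    qed
    show ?thesis using nil[of "\<lambda>v. s * x v + t * z v"] by (simp add: scale lin)
  qed
  consider (q) z where "q z \<noteq> 0" | (r) z where "r z \<noteq> 0" | (zero) "\<And>x. q x = 0" "\<And>x. r x = 0"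
    by metis
  then show ?thesis
  proof cases
    case q
    \<comment> \<open>A transvection with axis \<open>(a1, a2)\<close> and parameter
      \<open>s\<close> differs from the identity by \<open>p = - s * a1 * a2\<close>,
      \<open>q = s * a1 * a1\<close>, \<open>r = - s * a2 * a2\<close>. With axis
      \<open>(q z, - p z)\<close> the entry \<open>q x\<close> forces this parameter.\<close>
    define l where "l x = q x / q z / q z" for x
    have pr: "p x = q x / q z * p z \<and> r x = q x / q z * r z" for x
    proof (rule traceless_nilpotent_proportional[OF nil q])
      show "(s * p x + t * p z)\<^sup>2 + (s * q x + t * q z) * (s * r x + t * r z) = 0" for s t
        by (rule comb)
    qed
    have p: "p x = l x * q z * p z" and r: "r x = l x * q z * r z" and qq: "q x = l x * q z * q z" for x
      using q pr[of x] by (simp_all add: l_def)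
    have "q z * r z = - (p z * p z)" using nil[of z] by (simp add: power2_eq_square add_eq_0_iff)
    then have r': "r x = - (l x * p z * p z)" for x using r[of x] by (simp add: mult.assoc)
    have "affine_wrt l l"
      using affine_wrt_cmult[OF lin(2), of "1 / q z / q z"] by (simp add: l_def[abs_def])
    moreover have "(fst w + (p x * fst w + q x * snd w), snd w + (r x * fst w - p x * snd w)) =
        transvection (q z, - p z) (l x) w" for x w
      using p[of x] r'[of x] qq[of x] by (simp add: transvection_def cross2_def algebra_simps)
    ultimately show ?thesis by blast
  next
    case r
    define l where "l x = - (r x / r z / r z)" for x
    have "(p z)\<^sup>2 + r z * q z = 0" using nil[of z] by (simp add: mult.commute)
    have pq: "p x = r x / r z * p z \<and> q x = r x / r z * q z" for x
    proof (rule traceless_nilpotent_proportional[OF _ r])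
      show "(p z)\<^sup>2 + r z * q z = 0" by fact
      show "(s * p x + t * p z)\<^sup>2 + (s * r x + t * r z) * (s * q x + t * q z) = 0" for s t
        using comb[of s x t z] by (simp add: mult.commute)
    qed
    have p: "p x = - (l x * r z * p z)" and q: "q x = - (l x * r z * q z)" and rr: "r x = - (l x * r z * r z)" for x
      using r pq[of x] by (simp_all add: l_def)
    have "r z * q z = - (p z * p z)" using nil[of z] by (simp add: power2_eq_square add_eq_0_iff mult.commute)
    then have q': "q x = l x * p z * p z" for x using q[of x] by (simp add: mult.assoc)
    have "affine_wrt l l"
      using affine_wrt_cmult[OF lin(3), of "- (1 / r z / r z)"] by (simp add: l_def[abs_def])
    moreover have "(fst w + (p x * fst w + q x * snd w), snd w + (r x * fst w - p x * snd w)) =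
        transvection (p z, r z) (l x) w" for x w
      using p[of x] q'[of x] rr[of x] by (simp add: transvection_def cross2_def algebra_simps)
    ultimately show ?thesis by blast
  next
    case zero
    then have "p x = 0" for x using nil[of x] by simp
    with zero show ?thesis
      by (intro exI[of _ "(0, 0)"] exI[of _ "\<lambda>_. 0"]) (simp add: transvection_def affine_wrt_const)
  qed
qed

definition affine_layer :: "(('v \<Rightarrow> 'k::field) \<Rightarrow> 'k mat2) \<Rightarrow> bool" where
  "affine_layer M \<longleftrightarrow> (\<exists>f g h k lf lg lh lk. M = (\<lambda>x. (f x, g x, h x, k x)) \<and>
     affine_wrt f lf \<and> affine_wrt g lg \<and> affine_wrt h lh \<and> affine_wrt k lk)"

text \<open>Write \<open>M x\<close> as \<open>1 + C x\<close> times the value of \<open>M\<close>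
  at the origin, with \<open>C\<close> linear. Comparing the coefficients of \<open>t\<close> in the
  constant determinant along a line through the origin makes \<open>C x\<close> traceless and
  singular, so \<open>nilpotent_space\<close> applies.\<close>

lemma unimodular_layer:
  fixes M :: "('v \<Rightarrow> 'k::alg_closed_field) \<Rightarrow> 'k mat2"
  assumes "affine_layer M" and det: "\<And>x. det2 (M x) = \<delta>" "\<delta> \<noteq> 0"
  shows "\<exists>a l. affine_wrt l l \<and> (\<forall>x w. mat_vec (M x) w = transvection a (l x) (mat_vec (M (\<lambda>_. 0)) w))"
proof -
  obtain f g h k lf lg lh lk where M: "M = (\<lambda>x. (f x, g x, h x, k x))"
    and aff: "affine_wrt f lf" "affine_wrt g lg" "affine_wrt h lh" "affine_wrt k lk"
    using assms(1) unfolding affine_layer_def by blast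
  note lin = aff[THEN affine_wrt_linear(1)]
  define f0 g0 h0 k0 where "f0 = f (\<lambda>_. 0)" "g0 = g (\<lambda>_. 0)" "h0 = h (\<lambda>_. 0)" "k0 = k (\<lambda>_. 0)"
  note 0 = this
  have d0: "f0 * k0 - g0 * h0 = \<delta>" using det(1)[of "\<lambda>_. 0"] by (simp add: M 0)
  have ln: "f (line (\<lambda>_. 0) x t) = f0 + t * lf x" "g (line (\<lambda>_. 0) x t) = g0 + t * lg x"
    "h (line (\<lambda>_. 0) x t) = h0 + t * lh x" "k (line (\<lambda>_. 0) x t) = k0 + t * lk x" for x t
    using aff[THEN affine_wrtD] by (auto simp: 0)
  have M1: "f x = f0 + lf x" "g x = g0 + lg x" "h x = h0 + lh x" "k x = k0 + lk x" for x
    using ln[of x 1] by simp_all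
  have pol: "[:\<delta>, f0 * lk x + k0 * lf x - g0 * lh x - h0 * lg x, lf x * lk x - lg x * lh x:] = [:\<delta>:]" for x
  proof (rule poly_eqI_alg_closed)
    fix t
    have "(f0 + t * lf x) * (k0 + t * lk x) - (g0 + t * lg x) * (h0 + t * lh x) = \<delta>"
      using det(1)[of "line (\<lambda>_. 0) x t"] by (simp add: M ln)
    moreover have "poly [:\<delta>, f0 * lk x + k0 * lf x - g0 * lh x - h0 * lg x, lf x * lk x - lg x * lh x:] t =
      \<delta> + ((f0 + t * lf x) * (k0 + t * lk x) - (g0 + t * lg x) * (h0 + t * lh x)) - (f0 * k0 - g0 * h0)"
      by (simp add: algebra_simps)
    ultimately show "poly [:\<delta>, f0 * lk x + k0 * lf x - g0 * lh x - h0 * lg x, lf x * lk x - lg x * lh x:] t =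
      poly [:\<delta>:] t" by (simp add: d0)
  qed
  have tr: "f0 * lk x + k0 * lf x - g0 * lh x - h0 * lg x = 0" and dt: "lf x * lk x - lg x * lh x = 0" for x
    using pol[of x] by auto
  \<comment> \<open>The entries of \<open>C x\<close>: the linear part of \<open>M x\<close> times
    the inverse of \<open>M\<close> at the origin.\<close>
  define p q r u where "p x = 1 / \<delta> * (lf x * k0 - lg x * h0)" "q x = 1 / \<delta> * (lg x * f0 - lf x * g0)"
    "r x = 1 / \<delta> * (lh x * k0 - lk x * h0)" "u x = 1 / \<delta> * (lk x * f0 - lh x * g0)" for x
  note pqr = this
  have u: "u x = - p x" for x
  proof -
    have "p x + u x = 1 / \<delta> * (f0 * lk x + k0 * lf x - g0 * lh x - h0 * lg x)"
      by (simp add: pqr algebra_simps)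
    then show ?thesis using tr[of x] by (simp add: eq_neg_iff_add_eq_0 add.commute)
  qed
  have "p x * u x - q x * r x = 0" for x
  proof -
    have "p x * u x - q x * r x = (1 / \<delta>)\<^sup>2 * (f0 * k0 - g0 * h0) * (lf x * lk x - lg x * lh x)"
      unfolding pqr by (simp add: power2_eq_square algebra_simps)
    then show ?thesis using dt by simp
  qed
  then have nil: "(p x)\<^sup>2 + q x * r x = 0" for x
    by (metis (no_types) u add.inverse_inverse diff_minus_eq_add minus_diff_eq mult_minus_right
        neg_equal_0_iff_equal power2_eq_square add.commute)
  have lin': "affine_wrt p p" "affine_wrt q q" "affine_wrt r r"
    using lin unfolding affine_wrt_def pqr by (simp_all add: algebra_simps)
  obtain a l where l: "affine_wrt l l"
    and al: "\<And>x w. (fst w + (p x * fst w + q x * snd w), snd w + (r x * fst w - p x * snd w)) =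
      transvection a (l x) w"
    using nilpotent_space[OF lin' nil] by blast
  have "mat_vec (M x) w = transvection a (l x) (mat_vec (M (\<lambda>_. 0)) w)" for x w
  proof -
    obtain w1 w2 where w: "w = (w1, w2)" by (cases w)
    have e: "p x * f0 + q x * h0 = lf x" "p x * g0 + q x * k0 = lg x"
      "r x * f0 + u x * h0 = lh x" "r x * g0 + u x * k0 = lk x"
    proof -
      have "p x * f0 + q x * h0 = 1 / \<delta> * (f0 * k0 - g0 * h0) * lf x"
        "p x * g0 + q x * k0 = 1 / \<delta> * (f0 * k0 - g0 * h0) * lg x"
        "r x * f0 + u x * h0 = 1 / \<delta> * (f0 * k0 - g0 * h0) * lh x"
        "r x * g0 + u x * k0 = 1 / \<delta> * (f0 * k0 - g0 * h0) * lk x"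
        unfolding pqr by (simp_all add: algebra_simps)
      then show "p x * f0 + q x * h0 = lf x" "p x * g0 + q x * k0 = lg x"
        "r x * f0 + u x * h0 = lh x" "r x * g0 + u x * k0 = lk x" using det(2) by (simp_all add: d0)
    qed
    have "transvection a (l x) (mat_vec (M (\<lambda>_. 0)) w) =
      (f0 * w1 + g0 * w2 + (p x * (f0 * w1 + g0 * w2) + q x * (h0 * w1 + k0 * w2)),
       h0 * w1 + k0 * w2 + (r x * (f0 * w1 + g0 * w2) + u x * (h0 * w1 + k0 * w2)))"
      by (simp add: M w u flip: al 0)
    also have "\<dots> = ((f0 + (p x * f0 + q x * h0)) * w1 + (g0 + (p x * g0 + q x * k0)) * w2,
       (h0 + (r x * f0 + u x * h0)) * w1 + (k0 + (r x * g0 + u x * k0)) * w2)"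
      by (simp add: algebra_simps)
    finally show ?thesis by (simp add: M w e M1)
  qed
  with l show ?thesis by blast
qed

text \<open>Each matrix is a transvection times a constant matrix; the constant matrices are pushed
  right by conjugation and end up in the vector \<open>w'\<close>.\<close>

lemma chain_to_word:
  fixes Ms :: "(('v \<Rightarrow> 'k::alg_closed_field) \<Rightarrow> 'k mat2) list"
  assumes "\<And>M. M \<in> set Ms \<Longrightarrow> affine_layer M"
    and "\<And>M. M \<in> set Ms \<Longrightarrow> \<exists>\<delta>. \<delta> \<noteq> 0 \<and> (\<forall>x. det2 (M x) = \<delta>)"
  shows "\<exists>ts w'. (\<forall>(a, l)\<in>set ts. affine_wrt l l) \<and> (\<forall>x. chain_apply Ms x w = word_apply ts x w')"
  using assms
proof (induction Ms)
  case Nil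
  show ?case by (intro exI[of _ "[]"] exI[of _ w]) simp
next
  case (Cons M Ms)
  obtain ts w' where ts: "\<forall>(a, l)\<in>set ts. affine_wrt l l" "\<And>x. chain_apply Ms x w = word_apply ts x w'"
    using Cons.IH Cons.prems by auto
  obtain \<delta> where \<delta>: "\<delta> \<noteq> 0" "\<And>x. det2 (M x) = \<delta>" using Cons.prems(2)[of M] by auto
  obtain a l where l: "affine_wrt l l"
    and al: "\<And>x w. mat_vec (M x) w = transvection a (l x) (mat_vec (M (\<lambda>_. 0)) w)"
    using unimodular_layer[of M \<delta>] Cons.prems(1)[of M] \<delta> by (metis list.set_intros(1))
  define A where "A = M (\<lambda>_. 0)"
  define us where "us = map (\<lambda>(b, m). (mat_vec A b, \<lambda>x. inverse \<delta> * m x)) ts"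
  have dA: "det2 A = \<delta>" by (simp add: A_def \<delta>)
  have "mat_vec A (word_apply ts x w') = word_apply us x (mat_vec A w')" for x
    unfolding us_def
    by (induction ts) (auto simp: mat_vec_transvection dA \<delta>(1) divide_inverse mult.commute)
  then have "chain_apply (M # Ms) x w = word_apply ((a, l) # us) x (mat_vec A w')" for x
    by (simp add: ts(2) al[of x] flip: A_def)
  moreover have "\<forall>(a, l)\<in>set ((a, l) # us). affine_wrt l l"
    using ts(1) l by (auto simp: us_def intro!: affine_wrt_cmult)
  ultimately show ?case by blast
qed

section \<open>Reduced words of transvections and their leading terms\<close>

definition lead :: "('k vec2 \<times> (('v \<Rightarrow> 'k) \<Rightarrow> 'k)) list \<Rightarrow> 'k vec2 \<Rightarrow> 'k vec2" where
  "lead ts w = (case ts of [] \<Rightarrow> w | t # _ \<Rightarrow> fst t)"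

text \<open>Consecutive axes are never parallel, with \<open>w\<close> as the final axis. This keeps
  the leading term from cancelling; its direction is \<open>lead ts w\<close>.\<close>

primrec reduced :: "('k vec2 \<times> (('v \<Rightarrow> 'k) \<Rightarrow> 'k::field)) list \<Rightarrow> 'k vec2 \<Rightarrow> bool" where
  "reduced [] w \<longleftrightarrow> True"
| "reduced (t # ts) w \<longleftrightarrow> affine_wrt (snd t) (snd t) \<and> (\<exists>d. snd t d \<noteq> 0) \<and>
     cross2 (fst t) (lead ts w) \<noteq> 0 \<and> reduced ts w"

text \<open>Transvections with parallel axes merge into one by adding parameters. If the sum is zero
  both disappear, and the remaining tail is already reduced.\<close>

lemma reduced_Cons:
  fixes ts :: "('k::field vec2 \<times> (('v \<Rightarrow> 'k) \<Rightarrow> 'k)) list"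
  assumes ts: "reduced ts w" and l: "affine_wrt l l"
  shows "\<exists>us. reduced us w \<and> (\<forall>x. word_apply us x w = transvection a (l x) (word_apply ts x w))"
proof (cases "\<forall>x. l x = 0")
  case True
  with ts show ?thesis by (intro exI[of _ ts]) (simp add: transvection_def)
next
  case l0: False
  show ?thesis
  proof (cases "cross2 a (lead ts w) = 0")
    case False
    with ts l l0 show ?thesis by (intro exI[of _ "(a, l) # ts"]) auto
  next
    case parallel: True
    show ?thesis
    proof (cases ts)
      case Nil
      with parallel show ?thesis
        by (intro exI[of _ "[]"]) (simp add: lead_def transvection_def)
    next
      case (Cons t us)
      obtain b m where t: "t = (b, m)" by (cases t)
      have m: "affine_wrt m m" and us: "reduced us w" and b: "cross2 b (lead us w) \<noteq> 0"
        using ts by (auto simp: Cons t)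
      have "cross2 a b = 0" using parallel by (simp add: lead_def Cons t)
      moreover have "fst b \<noteq> 0 \<or> snd b \<noteq> 0" using b by (auto simp: cross2_def)
      ultimately have "\<exists>c. a = (c * fst b, c * snd b)"
        by (cases "fst b = 0")
          (auto simp: cross2_def field_simps prod_eq_iff intro: exI[of _ "snd a / snd b"] exI[of _ "fst a / fst b"])
      then obtain c where c: "a = (c * fst b, c * snd b)" by blast
      \<comment> \<open>The axis enters a transvection quadratically, hence the factor
        \<open>c\<^sup>2\<close> for the axis \<open>a\<close>, which is \<open>c\<close> times
        \<open>b\<close>.\<close>
      define n where "n x = c\<^sup>2 * l x + m x" for x
      have n: "affine_wrt n n"
        unfolding n_def[abs_def] by (intro affine_wrt_add affine_wrt_cmult l m)
      have comb: "transvection b (n x) w = transvection a (l x) (transvection b (m x) w)" for x w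
        by (simp add: transvection_def cross2_def c n_def power2_eq_square algebra_simps)
      show ?thesis
      proof (cases "\<forall>x. n x = 0")
        case True
        then have "transvection b (n x) v = v" for x v by (simp add: transvection_def)
        with us comb show ?thesis by (intro exI[of _ us]) (auto simp: Cons t)
      next
        case False
        with n us b show ?thesis by (intro exI[of _ "(b, n) # us"]) (simp add: Cons t comb)
      qed
    qed
  qed
qed

lemma reduced_exists:
  assumes "\<forall>(a, l)\<in>set ts. affine_wrt l l"
  shows "\<exists>us. reduced us w \<and> (\<forall>x. word_apply us x w = word_apply ts x w)"
  using assms
proof (induction ts)
  case (Cons t ts)
  obtain a l where t: "t = (a, l)" by (cases t)
  obtain us where us: "reduced us w" "\<And>x. word_apply us x w = word_apply ts x w"
    using Cons by auto
  with reduced_Cons[OF us(1), of l a] Cons.prems show ?case by (auto simp: t)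
qed (auto intro: exI[of _ "[]"])

text \<open>The functional \<open>cross2 h\<close> does not see a first transvection with axis
  parallel to \<open>h\<close>, so such transvections are stripped until the leading direction
  survives under \<open>cross2 h\<close>.\<close>

lemma reduced_left:
  assumes "reduced ts w"
  shows "\<exists>us. reduced us w \<and> (us = [] \<or> cross2 h (lead us w) \<noteq> 0) \<and>
    (\<forall>x. cross2 h (word_apply us x w) = cross2 h (word_apply ts x w))"
  using assms
proof (induction ts)
  case Nil
  show ?case by (intro exI[of _ "[]"]) simp
next
  case (Cons t ts)
  obtain a l where t: "t = (a, l)" by (cases t)
  show ?case
  proof (cases "cross2 h a = 0")
    case True
    with Cons show ?thesis by (auto simp: t cross2_transvection_parallel)
  next
    case False
    with Cons.prems show ?thesis by (intro exI[of _ "t # ts"]) (simp add: t lead_def)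
  qed
qed

text \<open>Each further transvection raises the degree by one and multiplies the top coefficient by
  \<open>l d\<close> and by the nonzero \<open>cross2 a (lead ts w)\<close>. The constant
  \<open>c\<close> collects the latter factors and so does not depend on the direction
  \<open>d\<close>.\<close>

lemma word_leading_coeff:
  assumes "reduced ts w"
  shows "\<exists>c. c \<noteq> 0 \<and> (\<forall>d. \<exists>p q. degree p \<le> length ts \<and> degree q \<le> length ts \<and>
    (\<forall>t. word_apply ts (line (\<lambda>_. 0) d t) w = (poly p t, poly q t)) \<and>
    coeff p (length ts) = c * (\<Prod>(a, l)\<leftarrow>ts. l d) * fst (lead ts w) \<and>
    coeff q (length ts) = c * (\<Prod>(a, l)\<leftarrow>ts. l d) * snd (lead ts w))"
  using assms
proof (induction ts)
  case Nil
  show ?case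
    by (intro exI[of _ 1] conjI allI exI[of _ "[:fst w:]"] exI[of _ "[:snd w:]"]) (simp_all add: lead_def)
next
  case (Cons t ts)
  obtain a l where t: "t = (a, l)" by (cases t)
  from Cons obtain c where c: "c \<noteq> 0" and IH: "\<And>d. \<exists>p q. degree p \<le> length ts \<and> degree q \<le> length ts \<and>
    (\<forall>t. word_apply ts (line (\<lambda>_. 0) d t) w = (poly p t, poly q t)) \<and>
    coeff p (length ts) = c * (\<Prod>(a, l)\<leftarrow>ts. l d) * fst (lead ts w) \<and>
    coeff q (length ts) = c * (\<Prod>(a, l)\<leftarrow>ts. l d) * snd (lead ts w)"
    by auto
  have l: "affine_wrt l l" and a: "cross2 a (lead ts w) \<noteq> 0" using Cons.prems by (auto simp: t)
  have ld: "l (line (\<lambda>_. 0) d s) = s * l d" for d s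
    using affine_wrtD[OF l] affine_wrt_linear(2)[OF l] by simp
  show ?case
  proof (intro exI[of _ "c * cross2 a (lead ts w)"] conjI allI)
    show "c * cross2 a (lead ts w) \<noteq> 0" using a c by simp
    fix d
    obtain p q where deg: "degree p \<le> length ts" "degree q \<le> length ts"
      and pq: "\<And>t. word_apply ts (line (\<lambda>_. 0) d t) w = (poly p t, poly q t)"
      and cf: "coeff p (length ts) = c * (\<Prod>(a, l)\<leftarrow>ts. l d) * fst (lead ts w)"
        "coeff q (length ts) = c * (\<Prod>(a, l)\<leftarrow>ts. l d) * snd (lead ts w)"
      using IH[of d] by (elim exE conjE) blast
    \<comment> \<open>The new transvection adds \<open>s * poly b s\<close> times \<open>a\<close>;
      the factor \<open>s\<close> comes from \<open>ld\<close> and becomes the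
      \<open>pCons 0\<close> below.\<close>
    define b where "b = smult (l d) (smult (fst a) q - smult (snd a) p)"
    have "degree b \<le> length ts"
      unfolding b_def using deg
      by (meson degree_diff_le degree_smult_le order.trans)
    have b': "poly b s = l d * cross2 a (poly p s, poly q s)" for s
      by (simp add: b_def cross2_def algebra_simps)
    have bc: "coeff b (length ts) = c * cross2 a (lead ts w) * (l d * (\<Prod>(a, l)\<leftarrow>ts. l d))"
      by (simp add: b_def cf cross2_def algebra_simps)
    have deg': "degree (f + pCons 0 (smult e b)) \<le> length (t # ts)" if "degree f \<le> length ts" for f e
      using that \<open>degree b \<le> length ts\<close>
      by (intro degree_add_le) (auto simp: degree_pCons_eq_if intro: order.trans[OF degree_smult_le])
    have cf': "coeff (f + pCons 0 (smult e b)) (length (t # ts)) = e * coeff b (length ts)"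
      if "degree f \<le> length ts" for f e
      using that by (simp add: coeff_eq_0)
    show "\<exists>p q. degree p \<le> length (t # ts) \<and> degree q \<le> length (t # ts) \<and>
      (\<forall>s. word_apply (t # ts) (line (\<lambda>_. 0) d s) w = (poly p s, poly q s)) \<and>
      coeff p (length (t # ts)) = c * cross2 a (lead ts w) * (\<Prod>(a, l)\<leftarrow>t # ts. l d) * fst (lead (t # ts) w) \<and>
      coeff q (length (t # ts)) = c * cross2 a (lead ts w) * (\<Prod>(a, l)\<leftarrow>t # ts. l d) * snd (lead (t # ts) w)"
      by (intro exI[of _ "p + pCons 0 (smult (fst a) b)"] exI[of _ "q + pCons 0 (smult (snd a) b)"]
            conjI allI deg' deg)
        (simp_all only: cf' deg bc, simp_all add: t pq transvection_def ld b' lead_def algebra_simps)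
  qed
qed

lemma reduced_prod_nonzero:
  fixes ts :: "('k::alg_closed_field vec2 \<times> (('v \<Rightarrow> 'k) \<Rightarrow> 'k)) list"
  assumes "reduced ts w"
  shows "\<exists>d. (\<Prod>(a, l)\<leftarrow>ts. l d) \<noteq> 0"
proof -
  have "polyfun (\<lambda>d. \<Prod>(a, l)\<leftarrow>ts. l d) \<and> (\<exists>d. (\<Prod>(a, l)\<leftarrow>ts. l d) \<noteq> 0)"
    using assms
  proof (induction ts)
    case Nil
    show ?case by (simp add: polyfun_const)
  next
    case (Cons t ts)
    obtain a l where t: "t = (a, l)" by (cases t)
    have l: "polyfun l" "\<exists>d. l d \<noteq> 0" using Cons.prems affine_wrt_polyfun by (auto simp: t)
    have ts: "polyfun (\<lambda>d. \<Prod>(a, l)\<leftarrow>ts. l d)" "\<exists>d. (\<Prod>(a, l)\<leftarrow>ts. l d) \<noteq> 0" using Cons by auto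
    have "\<exists>d. l d * (\<Prod>(a, l)\<leftarrow>ts. l d) \<noteq> 0"
      using polyfun_mult_eq_0[OF l(1) ts(1)] l(2) ts(2) by blast
    then show ?case using polyfun_mult[OF l(1) ts(1)] by (simp add: t)
  qed
  then show ?thesis by simp
qed

section \<open>The quadric is not computed by a unimodular chain\<close>

lemma two_equations_three_unknowns:
  fixes a1 a2 a3 b1 b2 b3 :: "'k::field"
  obtains c1 c2 c3 where "c1 \<noteq> 0 \<or> c2 \<noteq> 0 \<or> c3 \<noteq> 0"
    "c1 * a1 + c2 * a2 + c3 * a3 = 0" "c1 * b1 + c2 * b2 + c3 * b3 = 0"
proof -
  \<comment> \<open>The cross product of the two coefficient rows is a solution; when it vanishes,
    the rows are dependent and a solution is read off one of them.\<close>
  define n1 n2 n3 where "n1 = a2 * b3 - a3 * b2" "n2 = a3 * b1 - a1 * b3" "n3 = a1 * b2 - a2 * b1"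
  note n = this
  consider "n1 \<noteq> 0 \<or> n2 \<noteq> 0 \<or> n3 \<noteq> 0"
    | "n1 = 0" "n2 = 0" "n3 = 0" "a1 \<noteq> 0 \<or> a2 \<noteq> 0 \<or> a3 \<noteq> 0"
    | "a1 = 0" "a2 = 0" "a3 = 0" "b1 \<noteq> 0 \<or> b2 \<noteq> 0 \<or> b3 \<noteq> 0"
    | "a1 = 0" "a2 = 0" "a3 = 0" "b1 = 0" "b2 = 0" "b3 = 0"
    by blast
  then show thesis
  proof cases
    case 1
    then show thesis by (intro that[of n1 n2 n3]) (simp_all add: n algebra_simps)
  next
    case 2
    show thesis
    proof (cases "a1 = 0 \<and> a2 = 0")
      case True
      with 2 show thesis by (intro that[of 1 0 0]) (auto simp: n)
    next
      case False
      with 2 show thesis by (intro that[of "- a2" a1 0]) (auto simp: n algebra_simps)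
    qed
  next
    case 3
    then show thesis
      by (cases "b1 = 0 \<and> b2 = 0") (auto intro: that[of 1 0 0] that[of "- b2" b1 0])
  next
    case 4
    then show thesis by (intro that[of 1 0 0]) auto
  qed
qed

text \<open>The degree bound leaves at most two transvections in the reduced word, so the product only
  depends on two linear forms, whereas the quadric below is not constant along any direction in
  the span of \<open>d 2\<close>, \<open>d 3\<close>, \<open>d 4\<close>.  Here \<open>s 1\<close> may be a nonzero constant.\<close>
lemma quadric_not_unimodular_chain:
  fixes Ms :: "(('v \<Rightarrow> 'k::alg_closed_field) \<Rightarrow> 'k mat2) list"
  assumes Ms: "\<And>M. M \<in> set Ms \<Longrightarrow> affine_layer M"
      "\<And>M. M \<in> set Ms \<Longrightarrow> \<exists>\<delta>. \<delta> \<noteq> 0 \<and> (\<forall>x. det2 (M x) = \<delta>)"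
    and s: "\<And>i. i \<in> {1..4::nat} \<Longrightarrow> affine_wrt (s i) (l i)"
    and dir: "\<And>i k. i \<in> {1..4} \<Longrightarrow> k \<in> {2..4} \<Longrightarrow> l i (d k) = (if i = k then 1 else 0)"
    and s1: "s 1 z \<noteq> 0"
    and eq: "\<And>x. s 1 x * s 2 x + s 3 x * s 4 x = cross2 h (chain_apply Ms x w)"
  shows False
proof -
  have "\<exists>ts w'. (\<forall>(a, l)\<in>set ts. affine_wrt l l) \<and> (\<forall>x. chain_apply Ms x w = word_apply ts x w')"
    by (rule chain_to_word) (use Ms in blast)+
  then obtain ts0 w' where ts0: "\<forall>(a, l)\<in>set ts0. affine_wrt l l"
    and v0: "\<forall>x. chain_apply Ms x w = word_apply ts0 x w'"
    by blast
  obtain ts1 where ts1: "reduced ts1 w'" and v1: "\<forall>x. word_apply ts1 x w' = word_apply ts0 x w'"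
    using reduced_exists[OF ts0] by blast
  obtain ts where ts: "reduced ts w'" "ts = [] \<or> cross2 h (lead ts w') \<noteq> 0"
    and v: "\<forall>x. cross2 h (word_apply ts x w') = cross2 h (word_apply ts1 x w')"
    using reduced_left[OF ts1] by blast
  have val: "s 1 x * s 2 x + s 3 x * s 4 x = cross2 h (word_apply ts x w')" for x
    unfolding eq by (simp add: v0 v1 v)
  have "length ts \<le> 2"
  proof (rule ccontr)
    assume len: "\<not> length ts \<le> 2"
    obtain c where c: "c \<noteq> 0" and C: "\<And>d. \<exists>p q. degree p \<le> length ts \<and> degree q \<le> length ts \<and>
      (\<forall>t. word_apply ts (line (\<lambda>_. 0) d t) w' = (poly p t, poly q t)) \<and>
      coeff p (length ts) = c * (\<Prod>(a, l)\<leftarrow>ts. l d) * fst (lead ts w') \<and>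
      coeff q (length ts) = c * (\<Prod>(a, l)\<leftarrow>ts. l d) * snd (lead ts w')"
      using word_leading_coeff[OF ts(1)] by metis
    \<comment> \<open>In direction \<open>e\<close> no form of the word vanishes, so the coefficient
      of degree \<open>length ts\<close> is nonzero, whereas the quadric has degree at most
      two.\<close>
    obtain e where e: "(\<Prod>(a, l)\<leftarrow>ts. l e) \<noteq> 0" using reduced_prod_nonzero[OF ts(1)] by blast
    obtain p q where pq: "\<And>t. word_apply ts (line (\<lambda>_. 0) e t) w' = (poly p t, poly q t)"
      and cf: "coeff p (length ts) = c * (\<Prod>(a, l)\<leftarrow>ts. l e) * fst (lead ts w')"
        "coeff q (length ts) = c * (\<Prod>(a, l)\<leftarrow>ts. l e) * snd (lead ts w')"
      using C[of e] by blast
    define P where "P = smult (fst h) q - smult (snd h) p"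
    define S where "S i = [:s i (\<lambda>_. 0), l i e:]" for i
    have "P = S 1 * S 2 + S 3 * S 4"
    proof (rule poly_eqI_alg_closed)
      fix t
      have "s i (line (\<lambda>_. 0) e t) = poly (S i) t" if "i \<in> {1..4}" for i
        using affine_wrtD[OF s[OF that]] by (simp add: S_def)
      then have "poly (S 1 * S 2 + S 3 * S 4) t = cross2 h (word_apply ts (line (\<lambda>_. 0) e t) w')"
        by (simp flip: val)
      then show "poly P t = poly (S 1 * S 2 + S 3 * S 4) t"
        by (simp add: pq P_def cross2_def)
    qed
    moreover have "degree (S i * S j) \<le> 2" for i j
      unfolding S_def using degree_mult_le[of "S i" "S j"] by (simp add: S_def)
    ultimately have "degree P \<le> 2" by (auto intro: degree_add_le)
    then have "coeff P (length ts) = 0" using len by (simp add: coeff_eq_0)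
    moreover have "coeff P (length ts) = c * (\<Prod>(a, l)\<leftarrow>ts. l e) * cross2 h (lead ts w')"
      by (simp add: P_def cf cross2_def algebra_simps)
    moreover have "ts \<noteq> []" using len by auto
    ultimately show False using c e ts(2) by simp
  qed
  \<comment> \<open>The at most two forms left in the word, padded by zero forms or by
    repetition.\<close>
  then obtain m n where mn: "affine_wrt m m" "affine_wrt n n"
    "\<And>x y. m x = m y \<Longrightarrow> n x = n y \<Longrightarrow> word_apply ts x w' = word_apply ts y w'"
  proof -
    assume *: thesis if "affine_wrt m m" "affine_wrt n n"
      "\<And>x y. m x = m y \<Longrightarrow> n x = n y \<Longrightarrow> word_apply ts x w' = word_apply ts y w'" for m n
    consider "ts = []" | a l where "ts = [(a, l)]" | a l b k where "ts = [(a, l), (b, k)]"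
    proof (cases ts)
      case (Cons t us)
      then show ?thesis
        using that \<open>length ts \<le> 2\<close> by (cases t; cases us) (auto simp: neq_Nil_conv)
    qed (use that in blast)
    then show thesis
    proof cases
      case 1
      then show thesis by (intro *[of "\<lambda>_. 0" "\<lambda>_. 0"]) (auto intro: affine_wrt_const)
    next
      case (2 a l)
      then show thesis using ts(1) by (intro *[of l l]) auto
    next
      case (3 a l b k)
      then show thesis using ts(1) by (intro *[of l k]) auto
    qed
  qed
  obtain c2 c3 c4 where c: "c2 \<noteq> 0 \<or> c3 \<noteq> 0 \<or> c4 \<noteq> 0"
    "c2 * m (d 2) + c3 * m (d 3) + c4 * m (d 4) = 0" "c2 * n (d 2) + c3 * n (d 3) + c4 * n (d 4) = 0"
    by (rule two_equations_three_unknowns)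
  \<comment> \<open>Translation by a combination of \<open>d 2\<close>, \<open>d 3\<close>,
    \<open>d 4\<close> that \<open>m\<close> and \<open>n\<close> both kill, so the value of the
    word does not change.\<close>
  define mv where "mv x = line (line (line x (d 2) c2) (d 3) c3) (d 4) c4" for x
  have "m (mv x) = m x" "n (mv x) = n x" for x
    using c(2,3) by (simp_all add: mv_def affine_wrtD[OF mn(1)] affine_wrtD[OF mn(2)] add.assoc)
  then have inv: "s 1 x * s 2 x + s 3 x * s 4 x = s 1 (mv x) * s 2 (mv x) + s 3 (mv x) * s 4 (mv x)" for x
    using val mn(3)[of "mv x" x] by simp
  have sd: "s i (line x (d k) t) = s i x + (if i = k then t else 0)"
    if "i \<in> {1..4}" "k \<in> {2..4}" for i k x t
    using affine_wrtD[OF s] that by (simp add: dir)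
  have smv: "s 1 (mv x) = s 1 x" "s 2 (mv x) = s 2 x + c2" "s 3 (mv x) = s 3 x + c3" "s 4 (mv x) = s 4 x + c4" for x
    by (simp_all add: mv_def sd)
  have E: "s 1 x * c2 + s 3 x * c4 + c3 * s 4 x + c3 * c4 = 0" for x
    using inv[of x] by (simp add: smv algebra_simps del: One_nat_def)
  \<comment> \<open>Comparing \<open>E\<close> at points that differ along \<open>d 3\<close> or
    \<open>d 4\<close> gives \<open>c4 = 0\<close> and \<open>c3 = 0\<close>; at \<open>z\<close>
    only \<open>s 1 z * c2 = 0\<close> is left.\<close>
  have "c4 = 0" using E[of z] E[of "line z (d 3) 1"] by (simp add: sd algebra_simps del: One_nat_def)
  moreover have "c3 = 0" using E[of z] E[of "line z (d 4) 1"] calculation by (simp add: sd algebra_simps del: One_nat_def)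
  ultimately show False using E[of z] s1 c(1) by simp
qed

section \<open>Degenerate matrices\<close>

text \<open>\<open>Vs\<close> lists exactly the variables that occur, so an entry with nonempty
  \<open>Vs\<close> can be made zero through its variable.\<close>

definition simple_fun :: "'v set \<Rightarrow> (('v \<Rightarrow> 'k::field) \<Rightarrow> 'k) \<Rightarrow> bool" where
  "simple_fun Vs f \<longleftrightarrow> (Vs = {} \<and> (\<exists>c. f = (\<lambda>_. c))) \<or>
     (\<exists>v \<alpha> \<beta>. Vs = {v} \<and> \<alpha> \<noteq> 0 \<and> f = (\<lambda>x. \<alpha> * x v + \<beta>))"

definition simple_layer :: "'v set \<Rightarrow> (('v \<Rightarrow> 'k::field) \<Rightarrow> 'k mat2) \<Rightarrow> bool" where
  "simple_layer Vs M \<longleftrightarrow> (\<exists>f g h k X1 X2 X3 X4. M = (\<lambda>x. (f x, g x, h x, k x)) \<and>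
     simple_fun X1 f \<and> simple_fun X2 g \<and> simple_fun X3 h \<and> simple_fun X4 k \<and>
     Vs = X1 \<union> X2 \<union> X3 \<union> X4)"

lemma simple_fun_cong: "simple_fun Vs f \<Longrightarrow> (\<And>v. v \<in> Vs \<Longrightarrow> x v = y v) \<Longrightarrow> f x = f y"
  by (auto simp: simple_fun_def)

lemma simple_layer_cong: "simple_layer Vs M \<Longrightarrow> (\<And>v. v \<in> Vs \<Longrightarrow> x v = y v) \<Longrightarrow> M x = M y"
  unfolding simple_layer_def
  by (elim exE conjE) (simp, intro conjI; rule simple_fun_cong, assumption, simp)

lemma simple_fun_card: "simple_fun Vs f \<Longrightarrow> finite Vs \<and> card Vs \<le> 1"
  by (auto simp: simple_fun_def)

lemma simple_layer_card:
  assumes "simple_layer Vs M"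
  shows "finite Vs \<and> card Vs \<le> 4"
proof -
  obtain f g h k X1 X2 X3 X4 where "M = (\<lambda>x. (f x, g x, h x, k x))"
    and "simple_fun X1 f" "simple_fun X2 g" "simple_fun X3 h" "simple_fun X4 k"
    and Vs: "Vs = X1 \<union> X2 \<union> X3 \<union> X4"
    using assms unfolding simple_layer_def by blast
  then have "finite X1 \<and> card X1 \<le> 1" "finite X2 \<and> card X2 \<le> 1" "finite X3 \<and> card X3 \<le> 1"
    "finite X4 \<and> card X4 \<le> 1" by (auto dest: simple_fun_card)
  then show ?thesis
    using card_Un_le[of "X1 \<union> X2 \<union> X3" X4] card_Un_le[of "X1 \<union> X2" X3] card_Un_le[of X1 X2]
    by (auto simp: Vs)
qed

text \<open>Substitutions are encoded by \<open>override_on x s D\<close>: the point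
  \<open>x\<close> with the variables in \<open>D\<close> fixed at the values of
  \<open>s\<close>.\<close>

lemma affine_simple_fun:
  assumes "simple_fun Vs f"
  shows "\<exists>l. affine_wrt (\<lambda>x. f (override_on x s D)) l"
proof -
  consider c where "f = (\<lambda>_. c)" | v \<alpha> \<beta> where "f = (\<lambda>x. \<alpha> * x v + \<beta>)"
    using assms by (auto simp: simple_fun_def)
  then show ?thesis
  proof cases
    case 1
    then show ?thesis using affine_wrt_const by blast
  next
    case (2 v \<alpha> \<beta>)
    then have "affine_wrt (\<lambda>x. f (override_on x s D)) (\<lambda>d. if v \<in> D then 0 else \<alpha> * d v)"
      by (simp add: affine_wrt_def override_on_def line_def algebra_simps)
    then show ?thesis by blast
  qed
qed

lemma affine_simple_layer:
  assumes "simple_layer Vs M"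
  shows "affine_layer (\<lambda>x. M (override_on x s D))"
proof -
  obtain f g h k X1 X2 X3 X4 where M: "M = (\<lambda>x. (f x, g x, h x, k x))"
    and simple: "simple_fun X1 f" "simple_fun X2 g" "simple_fun X3 h" "simple_fun X4 k"
    using assms unfolding simple_layer_def by blast
  note l = simple[THEN affine_simple_fun[of _ _ s D]]
  from l(1) obtain lf where lf: "affine_wrt (\<lambda>x. f (override_on x s D)) lf" ..
  from l(2) obtain lg where lg: "affine_wrt (\<lambda>x. g (override_on x s D)) lg" ..
  from l(3) obtain lh where lh: "affine_wrt (\<lambda>x. h (override_on x s D)) lh" ..
  from l(4) obtain lk where lk: "affine_wrt (\<lambda>x. k (override_on x s D)) lk" ..
  show ?thesis
    unfolding affine_layer_def M by (intro exI conjI) (rule refl lf lg lh lk)+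
qed

lemma polyfun_det_affine_layer:
  assumes "affine_layer M"
  shows "polyfun (\<lambda>x. det2 (M x))"
proof -
  obtain f g h k lf lg lh lk where M: "M = (\<lambda>x. (f x, g x, h x, k x))"
    and aff: "affine_wrt f lf" "affine_wrt g lg" "affine_wrt h lh" "affine_wrt k lk"
    using assms unfolding affine_layer_def by blast
  note pf = aff[THEN affine_wrt_polyfun]
  show ?thesis
    using polyfun_diff[OF polyfun_mult[OF pf(1,4)] polyfun_mult[OF pf(2,3)]] by (simp add: M)
qed

lemma polyfun_chain_apply:
  assumes "\<And>M. M \<in> set Ms \<Longrightarrow> affine_layer M"
  shows "polyfun (\<lambda>x. fst (chain_apply Ms x w)) \<and> polyfun (\<lambda>x. snd (chain_apply Ms x w))"
  using assms
proof (induction Ms)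
  case (Cons M Ms)
  obtain f g h k lf lg lh lk where M: "M = (\<lambda>x. (f x, g x, h x, k x))"
    and aff: "affine_wrt f lf" "affine_wrt g lg" "affine_wrt h lh" "affine_wrt k lk"
    using Cons.prems[of M] unfolding affine_layer_def by auto
  note pf = aff[THEN affine_wrt_polyfun]
  have IH: "polyfun (\<lambda>x. fst (chain_apply Ms x w))" "polyfun (\<lambda>x. snd (chain_apply Ms x w))"
    using Cons by auto
  have mv: "mat_vec (a, b, c, d) v = (a * fst v + b * snd v, c * fst v + d * snd v)" for a b c d and v :: "'b vec2"
    by (cases v) simp
  show ?case
    using polyfun_add[OF polyfun_mult[OF pf(1) IH(1)] polyfun_mult[OF pf(2) IH(2)]]
      polyfun_add[OF polyfun_mult[OF pf(3) IH(1)] polyfun_mult[OF pf(4) IH(2)]]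
    by (simp add: M mv)
qed (simp add: polyfun_const)

lemma polyfun_cross2_chain_apply:
  assumes "\<And>M. M \<in> set Ms \<Longrightarrow> affine_layer M"
  shows "polyfun (\<lambda>x. cross2 h (chain_apply Ms x w))"
proof -
  have pf: "polyfun (\<lambda>x. fst (chain_apply Ms x w))" "polyfun (\<lambda>x. snd (chain_apply Ms x w))"
    using polyfun_chain_apply[OF assms] by auto
  show ?thesis
    unfolding cross2_def
    by (rule polyfun_diff[OF polyfun_mult[OF polyfun_const pf(2)] polyfun_mult[OF polyfun_const pf(1)]])
qed

lemma chain_apply_map_restrict:
  "chain_apply (map (\<lambda>M x. M (\<theta> x)) Ms) x w = chain_apply Ms (\<theta> x) w"
  by (induction Ms) auto

section \<open>Splitting a chain at a singular matrix\<close>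

definition vec_scale :: "'k::field \<Rightarrow> 'k vec2 \<Rightarrow> 'k vec2" where
  "vec_scale c w = (c * fst w, c * snd w)"

lemma mat_vec_scale: "mat_vec A (vec_scale c w) = vec_scale c (mat_vec A w)"
  by (cases A; cases w) (simp add: vec_scale_def algebra_simps)

lemma chain_apply_scale: "chain_apply Ms x (vec_scale c w) = vec_scale c (chain_apply Ms x w)"
  by (induction Ms) (simp_all add: mat_vec_scale)

lemma cross2_scale: "cross2 h (vec_scale c w) = c * cross2 h w" "cross2 (vec_scale c h) w = c * cross2 h w"
  by (simp_all add: cross2_def vec_scale_def algebra_simps)

text \<open>A singular matrix is a column \<open>g\<close> times a row, here the functional
  \<open>cross2 h\<close>. Putting this product into a chain splits its value into two
  factors.\<close>

lemma rank_one:
  assumes "det2 A = 0"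
  obtains g h where "\<And>w. mat_vec A w = vec_scale (cross2 h w) g"
proof -
  obtain a b c d where A: "A = (a, b, c, d)" by (cases A)
  have ad: "a * d = b * c" using assms by (simp add: A)
  have cd: "mat_vec A w = (a * fst w + b * snd w, c * fst w + d * snd w)" for w
    by (cases w) (simp add: A)
  show thesis
  proof (cases "a = 0 \<and> b = 0")
    case True
    then show thesis
      by (intro that[of "(d, - c)" "(0, 1)"]) (simp add: cd vec_scale_def cross2_def algebra_simps)
  next
    case False
    then obtain t where "c = t * a" "d = t * b"
    proof (cases "a = 0")
      case True
      with False that[of "d / b"] ad show thesis by auto
    next
      case a: False
      have "d = c / a * b" using a ad by (simp add: field_simps)
      with a that[of "c / a"] show thesis by simp
    qed
    then show thesis
      by (intro that[of "(b, - a)" "(1, t)"]) (simp add: cd vec_scale_def cross2_def algebra_simps)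
  qed
qed

section \<open>Row sums under substitutions, and the choice of a zero\<close>

definition row_sum :: "nat \<Rightarrow> (nat \<times> nat \<Rightarrow> 'k::field) \<Rightarrow> 'k" where
  "row_sum i x = (\<Sum>j=1..7. x (i, j))"

lemma affine_row_sum:
  "affine_wrt (\<lambda>x. row_sum i (override_on x s D)) (\<lambda>d. \<Sum>j=1..7. if (i, j) \<in> D then 0 else d (i, j))"
  unfolding row_sum_def
  by (intro affine_wrt_sum) (simp add: affine_wrt_def override_on_def line_def)

text \<open>The unit vectors of free variables, one for each row, are dual to the linear parts of
  the restricted row sums, as the lemmas on quadrics require.\<close>

lemma row_sum_direction:
  fixes i j k :: nat
  assumes "j \<in> {1..7}" "(k, j) \<notin> D"
  shows "(\<Sum>j'=1..7. if (i, j') \<in> D then 0 else (if (i, j') = (k, j) then 1 else 0)) =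
    (if i = k then 1 else (0 :: 'k::field))"
proof -
  have "(\<Sum>j'=1..7. if (i, j') \<in> D then 0 else (if (i, j') = (k, j) then 1 else 0 :: 'k)) =
    (\<Sum>j'=1..7. if j' = j then (if i = k then 1 else 0) else 0)"
    using assms by (intro sum.cong) auto
  then show ?thesis using assms(1) by (simp add: sum.delta)
qed

text \<open>Two rows have 14 variables together, more than the at most eight fixed ones.\<close>

lemma covered_row_unique:
  assumes "finite D" "card D \<le> 8" "{i} \<times> {1..7::nat} \<subseteq> D" "{k::nat} \<times> {1..7} \<subseteq> D"
  shows "i = k"
proof (rule ccontr)
  assume "i \<noteq> k"
  then have "card ({i, k} \<times> {1..7::nat}) = 14" by (simp add: card_cartesian_product)
  moreover have "{i, k} \<times> {1..7::nat} \<subseteq> D" using assms(3,4) by blast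
  ultimately have "14 \<le> card D" using card_mono[OF assms(1)] by metis
  then show False using assms(2) by simp
qed

text \<open>Each entry has at most one variable, so two variables outside \<open>D\<close> belong to
  different entries, and each entry is solved for its own variable.\<close>

lemma simple_row_zero:
  assumes f: "simple_fun Vs f" and g: "simple_fun Y g" and card: "card ((Vs \<union> Y) - D) \<ge> 2"
  obtains a b r t where "a \<noteq> b" "a \<notin> D" "b \<notin> D" "\<And>x. x a = r \<Longrightarrow> x b = t \<Longrightarrow> f x = 0 \<and> g x = 0"
proof -
  have Vs: "finite Vs" "card Vs \<le> 1" and Y: "finite Y" "card Y \<le> 1"
    using f g simple_fun_card by blast+
  have "(Vs \<union> Y) - D = (Vs - D) \<union> (Y - D)" by auto
  then have "2 \<le> card (Vs - D) + card (Y - D)" using card card_Un_le[of "Vs - D" "Y - D"] by simp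
  moreover have "card (Vs - D) \<le> card Vs" "card (Y - D) \<le> card Y" using Vs Y by (auto intro: card_mono)
  ultimately have "card Vs = 1" "card Y = 1" "card (Vs - D) = 1" "card (Y - D) = 1" using Vs Y by linarith+
  then obtain a \<alpha> \<beta> b \<gamma> \<delta> where a: "Vs = {a}" "\<alpha> \<noteq> 0" "f = (\<lambda>x. \<alpha> * x a + \<beta>)"
    and b: "Y = {b}" "\<gamma> \<noteq> 0" "g = (\<lambda>x. \<gamma> * x b + \<delta>)"
    using f g by (auto simp: simple_fun_def)
  have "a \<notin> D" "b \<notin> D" using \<open>card (Vs - D) = 1\<close> \<open>card (Y - D) = 1\<close> a(1) b(1)
    by (auto simp: insert_Diff_if split: if_splits)
  moreover have "a \<noteq> b" using card a(1) b(1) by (auto simp: insert_Diff_if split: if_splits)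
  ultimately show thesis
    using a b by (intro that[of a b "- \<beta> / \<alpha>" "- \<delta> / \<gamma>"]) auto
qed

text \<open>If no row of variables is covered, any zero of the determinant will do; it exists
  because a zero-free polynomial function is constant. If a row is covered, at least three variables
  of \<open>Vs\<close> lie outside \<open>D\<close>, so one of the two matrix rows contains two of
  them and can be made zero by these two alone.\<close>

lemma degenerate_assignment:
  fixes M :: "(nat \<times> nat \<Rightarrow> 'k::alg_closed_field) \<Rightarrow> 'k mat2"
  assumes M: "simple_layer Vs M" and D: "finite D" "card D \<le> 4"
    and deg: "\<not> (\<exists>\<delta>. \<delta> \<noteq> 0 \<and> (\<forall>x. det2 (M (override_on x s D)) = \<delta>))"
  obtains s' where "\<And>v. v \<in> D \<Longrightarrow> s' v = s v" "det2 (M s') = 0"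
    "\<And>i. {i} \<times> {1..7} \<subseteq> D \<union> Vs \<Longrightarrow> row_sum i s' \<noteq> 0"
proof (cases "\<exists>i. {i} \<times> {1..7} \<subseteq> D \<union> Vs")
  case False
  have "\<exists>x. det2 (M (override_on x s D)) = 0"
  proof (rule ccontr)
    assume *: "\<not> ?thesis"
    have "polyfun (\<lambda>x. det2 (M (override_on x s D)))"
      using affine_simple_layer[OF M, of s D] by (rule polyfun_det_affine_layer)
    then have "det2 (M (override_on x s D)) = det2 (M (override_on y s D))" for x y
      using * polyfun_no_zero_const[of "\<lambda>x. det2 (M (override_on x s D))"] by blast
    then show False using deg * by blast
  qed
  then obtain x where "det2 (M (override_on x s D)) = 0" ..
  with False show thesis by (intro that[of "override_on x s D"]) auto
next
  case True
  then obtain i where i: "{i} \<times> {1..7} \<subseteq> D \<union> Vs" by blast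
  have Vs: "finite Vs" "card Vs \<le> 4" using simple_layer_card[OF M] by auto
  have DX: "finite (D \<union> Vs)" "card (D \<union> Vs) \<le> 8"
    using D Vs card_Un_le[of D Vs] by auto
  have "card ({i} \<times> {1..7::nat}) = 7" by (simp add: card_cartesian_product)
  then have "7 \<le> card (D \<union> Vs)" using card_mono[OF DX(1) i] by simp
  also have "\<dots> \<le> card D + card (Vs - D)" using card_Un_le[of D "Vs - D"] by simp
  finally have X3: "3 \<le> card (Vs - D)" using D(2) by linarith
  obtain f g h k X1 X2 Y1 Y2 where Mf: "M = (\<lambda>x. (f x, g x, h x, k x))"
    and fs: "simple_fun X1 f" "simple_fun X2 g" "simple_fun Y1 h" "simple_fun Y2 k"
    and XX: "Vs = X1 \<union> X2 \<union> Y1 \<union> Y2"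
    using M unfolding simple_layer_def by blast
  have "Vs - D = ((X1 \<union> X2) - D) \<union> ((Y1 \<union> Y2) - D)" by (auto simp: XX)
  then have "3 \<le> card ((X1 \<union> X2) - D) + card ((Y1 \<union> Y2) - D)"
    using X3 card_Un_le[of "(X1 \<union> X2) - D" "(Y1 \<union> Y2) - D"] by simp
  then have "2 \<le> card ((X1 \<union> X2) - D) \<or> 2 \<le> card ((Y1 \<union> Y2) - D)" by linarith
  then obtain a b r t where ab: "a \<noteq> b" "a \<notin> D" "b \<notin> D"
    and zero: "\<And>x. x a = r \<Longrightarrow> x b = t \<Longrightarrow> det2 (M x) = 0"
  proof
    assume "2 \<le> card ((X1 \<union> X2) - D)"
    then obtain a b r t where "a \<noteq> b" "a \<notin> D" "b \<notin> D"
      and "\<And>x. x a = r \<Longrightarrow> x b = t \<Longrightarrow> f x = 0 \<and> g x = 0"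
      using simple_row_zero[OF fs(1,2)] by metis
    then show thesis by (intro that[of a b r t]) (simp_all add: Mf)
  next
    assume "2 \<le> card ((Y1 \<union> Y2) - D)"
    then obtain a b r t where "a \<noteq> b" "a \<notin> D" "b \<notin> D"
      and "\<And>x. x a = r \<Longrightarrow> x b = t \<Longrightarrow> h x = 0 \<and> k x = 0"
      using simple_row_zero[OF fs(3,4)] by metis
    then show thesis by (intro that[of a b r t]) (simp_all add: Mf)
  qed
  \<comment> \<open>Outside \<open>D\<close> only \<open>a\<close> and \<open>b\<close> have
    prescribed values, so at most six variables are taken and row \<open>i\<close> of seven keeps a
    free one.\<close>
  have "card (D \<union> {a, b}) \<le> 6" using card_Un_le[of D "{a, b}"] ab(1) D(2) by simp
  then have "\<not> {i} \<times> {1..7} \<subseteq> D \<union> {a, b}"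
    using card_mono[of "D \<union> {a, b}" "{i} \<times> {1..7::nat}"] D(1) \<open>card ({i} \<times> {1..7::nat}) = 7\<close> by auto
  then obtain j where "j \<in> {1..7}" "(i, j) \<notin> D \<union> {a, b}" by blast
  then have j: "j \<in> {1..7}" "(i, j) \<notin> D" "(i, j) \<noteq> a" "(i, j) \<noteq> b" by simp_all
  define s0 where "s0 = (override_on (\<lambda>_. 0) s D)(a := r, b := t)"
  \<comment> \<open>The sums of row \<open>i\<close> under \<open>s0\<close> and \<open>s1\<close>
    differ by one, so at least one of the two assignments qualifies.\<close>
  define s1 where "s1 = s0((i, j) := s0 (i, j) + 1)"
  have agree: "s0 v = s v" "s1 v = s v" if "v \<in> D" for v
    using that ab j by (auto simp: s0_def s1_def)
  have z: "det2 (M s0) = 0" "det2 (M s1) = 0"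
    using ab j by (intro zero; simp add: s0_def s1_def)+
  have "row_sum i s1 = row_sum i s0 + (\<Sum>j'=1..7. if j' = j then 1 else 0)"
    unfolding row_sum_def sum.distrib[symmetric] by (intro sum.cong) (auto simp: s1_def)
  then have "row_sum i s1 = row_sum i s0 + 1" using j(1) by (simp add: sum.delta)
  then have "row_sum i s0 \<noteq> 0 \<or> row_sum i s1 \<noteq> 0" by auto
  moreover have "k = i" if "{k} \<times> {1..7} \<subseteq> D \<union> Vs" for k
    using covered_row_unique[OF DX that i] .
  ultimately show thesis using that[of s0] that[of s1] agree z by metis
qed

text \<open>At most one row sum becomes constant, and then it is nonzero by assumption; after
  reordering it takes the place of \<open>s 1\<close> in
  \<open>quadric_not_unimodular_chain\<close>.\<close>

lemma p_not_unimodular_chain: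
  fixes Ms :: "((nat \<times> nat \<Rightarrow> 'k::alg_closed_field) \<Rightarrow> 'k mat2) list"
  assumes D: "finite D" "card D \<le> 8"
    and simple: "\<And>M. M \<in> set Ms \<Longrightarrow> \<exists>Vs. simple_layer Vs M"
    and unimod: "\<And>M. M \<in> set Ms \<Longrightarrow> \<exists>\<delta>. \<delta> \<noteq> 0 \<and> (\<forall>x. det2 (M (override_on x s D)) = \<delta>)"
    and covered: "\<And>i. {i} \<times> {1..7} \<subseteq> D \<Longrightarrow> row_sum i s \<noteq> 0"
    and eq: "\<And>x. row_sum 1 (override_on x s D) * row_sum 2 (override_on x s D) +
       row_sum 3 (override_on x s D) * row_sum 4 (override_on x s D) =
       cross2 h (chain_apply Ms (override_on x s D) w)"
  shows False
proof -
  define S where "S i x = row_sum i (override_on x s D)" for i x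
  define l where "l i d = (\<Sum>j=1..7. if (i, j) \<in> D then 0 else d (i, j))" for i and d :: "nat \<times> nat \<Rightarrow> 'k"
  have aff: "affine_wrt (S i) (l i)" for i
    using affine_row_sum[of i s D] by (simp add: S_def[abs_def] l_def[abs_def])
  \<comment> \<open>The only row that \<open>D\<close> may cover, or an arbitrary one if there is
    none.\<close>
  obtain i0 where i0: "i0 \<in> {1..4}" "\<And>k. k \<in> {1..4} \<Longrightarrow> k \<noteq> i0 \<Longrightarrow> \<not> {k} \<times> {1..7} \<subseteq> D"
    using covered_row_unique[OF D] that[of 1]
    by (metis atLeastAtMost_iff le_refl one_le_numeral)
  define J where "J k = (SOME j. j \<in> {1..7} \<and> (k, j) \<notin> D)" for k
  have J: "J k \<in> {1..7} \<and> (k, J k) \<notin> D" if "\<not> {k} \<times> {1..7} \<subseteq> D" for k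
    unfolding J_def by (rule someI_ex) (use that in auto)
  define e :: "nat \<Rightarrow> nat \<times> nat \<Rightarrow> 'k" where "e k v = (if v = (k, J k) then 1 else 0)" for k v
  have le: "l i (e k) = (if i = k then 1 else 0)" if "\<not> {k} \<times> {1..7} \<subseteq> D" for i k
    unfolding l_def e_def using J[OF that] by (intro row_sum_direction) auto
  have "\<exists>z. S i0 z \<noteq> 0"
  proof (cases "{i0} \<times> {1..7} \<subseteq> D")
    case True
    then have "(i0, j) \<in> D" if "j \<in> {1..7}" for j using that by blast
    then have "S i0 z = row_sum i0 s" for z
      unfolding S_def row_sum_def by (intro sum.cong) auto
    with covered[OF True] show ?thesis by simp
  next
    case False
    have "S i0 (line (\<lambda>_. 0) (e i0) (1 - S i0 (\<lambda>_. 0))) = 1"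
      by (simp add: affine_wrtD[OF aff] le[OF False])
    then show ?thesis by (metis zero_neq_one)
  qed
  then obtain z where z: "S i0 z \<noteq> 0" ..
  \<comment> \<open>Swapping factors and summands moves row \<open>i0\<close> to the first
    place.\<close>
  have "\<exists>\<pi> :: nat \<Rightarrow> nat. \<pi> 1 = i0 \<and> inj_on \<pi> {1..4} \<and> \<pi> ` {1..4} \<subseteq> {1..4::nat} \<and>
    (\<forall>x. S (\<pi> 1) x * S (\<pi> 2) x + S (\<pi> 3) x * S (\<pi> 4) x = S 1 x * S 2 x + S 3 x * S 4 x)"
  proof -
    have atL: "{1..4} = {1, 2, 3, 4::nat}" by auto
    consider "i0 = 1" | "i0 = 2" | "i0 = 3" | "i0 = 4" using i0(1) unfolding atL by blast
    then show ?thesis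
    proof cases
      case 1
      then show ?thesis by (intro exI[of _ id]) (auto simp: algebra_simps)
    next
      case 2
      then show ?thesis
        by (intro exI[of _ "\<lambda>k. if k = 1 then 2 else if k = 2 then 1 else k"])
          (auto simp: atL algebra_simps simp del: One_nat_def)
    next
      case 3
      then show ?thesis
        by (intro exI[of _ "\<lambda>k. if k = 1 then 3 else if k = 2 then 4 else if k = 3 then 1 else 2"])
          (auto simp: atL algebra_simps simp del: One_nat_def)
    next
      case 4
      then show ?thesis
        by (intro exI[of _ "\<lambda>k. if k = 1 then 4 else if k = 2 then 3 else if k = 3 then 1 else 2"])
          (auto simp: atL algebra_simps simp del: One_nat_def)
    qed
  qed
  then obtain \<pi> :: "nat \<Rightarrow> nat" where \<pi>: "\<pi> 1 = i0" "inj_on \<pi> {1..4}" "\<pi> ` {1..4} \<subseteq> {1..4::nat}"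
    and P: "\<forall>x. S (\<pi> 1) x * S (\<pi> 2) x + S (\<pi> 3) x * S (\<pi> 4) x = S 1 x * S 2 x + S 3 x * S 4 x"
    by blast
  define Ns where "Ns = map (\<lambda>M x. M (override_on x s D)) Ms"
  show False
  proof (rule quadric_not_unimodular_chain[of Ns "\<lambda>i. S (\<pi> i)" "\<lambda>i. l (\<pi> i)" "\<lambda>k. e (\<pi> k)" z h w])
    show "affine_layer M" if "M \<in> set Ns" for M
      using that simple affine_simple_layer by (fastforce simp: Ns_def)
    show "\<exists>\<delta>. \<delta> \<noteq> 0 \<and> (\<forall>x. det2 (M x) = \<delta>)" if "M \<in> set Ns" for M
      using that unimod by (auto simp: Ns_def)
    show "affine_wrt (S (\<pi> i)) (l (\<pi> i))" for i by (rule aff)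
    show "l (\<pi> i) (e (\<pi> k)) = (if i = k then 1 else 0)" if "i \<in> {1..4}" "k \<in> {2..4}" for i k
    proof -
      have k: "k \<in> {1..4}" "k \<noteq> 1" using that by auto
      then have "\<pi> k \<in> {1..4}" using \<pi>(3) by blast
      moreover have "\<pi> k \<noteq> i0" using inj_onD[OF \<pi>(2), of k 1] k by (simp only: \<pi>(1)) auto
      ultimately have "l (\<pi> i) (e (\<pi> k)) = (if \<pi> i = \<pi> k then 1 else 0)" using le i0(2) by blast
      then show ?thesis using inj_on_eq_iff[OF \<pi>(2) that(1) k(1)] by simp
    qed
    show "S (\<pi> 1) z \<noteq> 0" using z unfolding \<pi>(1) .
    show "S (\<pi> 1) x * S (\<pi> 2) x + S (\<pi> 3) x * S (\<pi> 4) x = cross2 h (chain_apply Ns x w)" for x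
      using eq[of x] P by (simp only: S_def Ns_def chain_apply_map_restrict)
  qed
qed

section \<open>The induction over suffixes of the chain\<close>

lemma p_not_simple_chain:
  fixes Ms :: "((nat \<times> nat \<Rightarrow> 'k::alg_closed_field) \<Rightarrow> 'k mat2) list"
  assumes simple: "\<And>M. M \<in> set Ms \<Longrightarrow> \<exists>Vs. simple_layer Vs M"
    and eq: "\<And>x. row_sum 1 x * row_sum 2 x + row_sum 3 x * row_sum 4 x = cross2 h0 (chain_apply Ms x w)"
  shows False
proof -
  define P :: "(nat \<times> nat \<Rightarrow> 'k) \<Rightarrow> 'k" where
    "P x = row_sum 1 x * row_sum 2 x + row_sum 3 x * row_sum 4 x" for x
  \<comment> \<open>Strong induction on the length of \<open>ys\<close>, with the fixed set, its
    values and the functional \<open>h\<close> arbitrary, since all of them change with the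
    suffix.\<close>
  have "False" if "Ms = zs @ ys" "finite D" "card D \<le> 4"
    "\<And>x. P (override_on x s D) = cross2 h (chain_apply ys (override_on x s D) w)" for ys zs D s h
    using that
  proof (induction "length ys" arbitrary: ys zs D s h rule: less_induct)
    case less
    define good where "good M \<longleftrightarrow> (\<exists>\<delta>. \<delta> \<noteq> 0 \<and> (\<forall>x. det2 (M (override_on x s D)) = \<delta>))"
      for M :: "(nat \<times> nat \<Rightarrow> 'k) \<Rightarrow> 'k mat2"
    show False
    proof (cases "\<forall>M\<in>set ys. good M")
      case True
      show False
      proof (rule p_not_unimodular_chain[of D ys s h w])
        show "finite D" "card D \<le> 8" using less.prems by auto
        show "\<exists>Vs. simple_layer Vs M" if "M \<in> set ys" for M using simple that less.prems(1) by auto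
        show "\<exists>\<delta>. \<delta> \<noteq> 0 \<and> (\<forall>x. det2 (M (override_on x s D)) = \<delta>)" if "M \<in> set ys" for M
          using True that by (simp add: good_def)
        show "row_sum i s \<noteq> 0" if "{i} \<times> {1..7} \<subseteq> D" for i
        proof -
          have "card ({i} \<times> {1..7::nat}) \<le> 4"
            using card_mono[OF less.prems(2) that] less.prems(3) by simp
          then have False by (simp add: card_cartesian_product)
          then show ?thesis ..
        qed
      qed (use less.prems(4) in \<open>simp add: P_def\<close>)
    next
      case False
      then obtain us M vs where ys: "ys = us @ M # vs" and M: "\<not> good M" and us: "\<forall>N\<in>set us. good N"
        using split_list_first_prop[of ys "\<lambda>M. \<not> good M"] by blast
      obtain Vs where Vs: "simple_layer Vs M" using simple[of M] less.prems(1) ys by auto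
      have cX: "finite Vs" "card Vs \<le> 4" using simple_layer_card[OF Vs] by auto
      obtain s' where s': "\<And>v. v \<in> D \<Longrightarrow> s' v = s v" "det2 (M s') = 0"
        "\<And>i. {i} \<times> {1..7} \<subseteq> D \<union> Vs \<Longrightarrow> row_sum i s' \<noteq> 0"
        using degenerate_assignment[OF Vs less.prems(2,3)] M unfolding good_def by metis
      obtain g h' where gh: "\<And>v. mat_vec (M s') v = vec_scale (cross2 h' v) g"
        using rank_one[OF s'(2)] by metis
      \<comment> \<open>Only \<open>Vs\<close> is fixed here and not \<open>D\<close>: the
        factorisation starts from the whole chain \<open>Ms\<close>, so a shorter suffix again has
        at most four fixed variables.\<close>
      define \<tau> where "\<tau> x = override_on x s' Vs" for x
      define L where "L x = cross2 h0 (chain_apply (zs @ us) (\<tau> x) g)" for x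
      define R where "R x = cross2 h' (chain_apply vs (\<tau> x) w)" for x
      have M\<tau>: "M (\<tau> x) = M s'" for x
        by (rule simple_layer_cong[OF Vs]) (simp add: \<tau>_def)
      have LR: "L x * R x = P (\<tau> x)" for x
        using eq[of "\<tau> x"]
        by (simp add: P_def less.prems(1) ys M\<tau> gh L_def R_def chain_apply_scale cross2_scale)
      have chain_pf: "polyfun (\<lambda>x. cross2 k (chain_apply Ns (\<tau> x) v))" if "set Ns \<subseteq> set Ms" for k Ns v
      proof -
        have "polyfun (\<lambda>x. cross2 k (chain_apply (map (\<lambda>M x. M (\<tau> x)) Ns) x v))"
          using that simple affine_simple_layer
          by (intro polyfun_cross2_chain_apply) (fastforce simp: \<tau>_def)
        then show ?thesis by (simp add: chain_apply_map_restrict)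
      qed
      have pf: "polyfun L" "polyfun R"
        unfolding L_def[abs_def] R_def[abs_def]
        by (rule chain_pf; simp add: less.prems(1) ys; blast)+
      define l where "l i d = (\<Sum>j=1..7. if (i, j) \<in> Vs then 0 else d (i, j))" for i and d :: "nat \<times> nat \<Rightarrow> 'k"
      have "\<exists>j. j \<in> {1..7} \<and> (k, j) \<notin> Vs" for k
      proof -
        have "\<not> {k} \<times> {1..7::nat} \<subseteq> Vs"
          using card_mono[OF cX(1), of "{k} \<times> {1..7::nat}"] cX(2) by (auto simp: card_cartesian_product)
        then show ?thesis by auto
      qed
      then obtain J where J: "\<And>k. J k \<in> {1..7} \<and> (k, J k) \<notin> Vs" by metis
      define e :: "nat \<Rightarrow> nat \<times> nat \<Rightarrow> 'k" where "e k v = (if v = (k, J k) then 1 else 0)" for k v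
      have "(\<exists>c. \<forall>x. L x = c) \<or> (\<exists>c. \<forall>x. R x = c)"
      proof (rule quadric_irreducible[OF pf, of "\<lambda>i x. row_sum i (\<tau> x)" l e])
        show "affine_wrt (\<lambda>x. row_sum i (\<tau> x)) (l i)" for i
          using affine_row_sum[of i s' Vs] by (simp add: l_def[abs_def] \<tau>_def)
        show "l i (e k) = (if i = k then 1 else 0)" for i k
          unfolding l_def e_def using J[of k] by (intro row_sum_direction) auto
        show "L x * R x = row_sum 1 (\<tau> x) * row_sum 2 (\<tau> x) + row_sum 3 (\<tau> x) * row_sum 4 (\<tau> x)" for x
          by (simp add: LR P_def)
      qed
      then show False
      proof (elim disjE exE)
        \<comment> \<open>The constant \<open>L\<close> is absorbed into the functional, so the
          shorter suffix \<open>vs\<close> computes \<open>P\<close>.\<close>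
        fix c assume "\<forall>x. L x = c"
        then have "P (override_on x s' Vs) = cross2 (vec_scale c h') (chain_apply vs (override_on x s' Vs) w)" for x
          using LR[of x] by (simp add: R_def cross2_scale \<tau>_def)
        moreover have "Ms = (zs @ us @ [M]) @ vs" "length vs < length ys"
          by (simp_all add: less.prems(1) ys)
        ultimately show False using less.hyps cX by blast
      next
        fix c assume c: "\<forall>x. R x = c"
        \<comment> \<open>The suffix identity is known with \<open>D\<close> fixed, and
          \<open>R\<close> is constant with \<open>Vs\<close> fixed, so both sets are fixed at
          \<open>s'\<close>, which agrees with \<open>s\<close> on \<open>D\<close>. Everything from
          \<open>M\<close> on then sends \<open>w\<close> to the constant vector
          \<open>vec_scale c g\<close>, and \<open>us\<close> alone computes
          \<open>P\<close>.\<close>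
        define \<theta> where "\<theta> x = override_on x s' (D \<union> Vs)" for x
        have \<theta>: "override_on (\<theta> x) s D = \<theta> x" "\<tau> (\<theta> x) = \<theta> x" for x
          by (auto simp: \<theta>_def \<tau>_def override_on_def s'(1))
        have cDX: "finite (D \<union> Vs)" "card (D \<union> Vs) \<le> 8"
          using cX less.prems(2,3) card_Un_le[of D Vs] by auto
        show False
        proof (rule p_not_unimodular_chain[OF cDX, of us s' h "vec_scale c g"])
          show "\<exists>Vs. simple_layer Vs N" if "N \<in> set us" for N
            by (rule simple) (simp add: that less.prems(1) ys)
          show "\<exists>\<delta>. \<delta> \<noteq> 0 \<and> (\<forall>x. det2 (N (override_on x s' (D \<union> Vs))) = \<delta>)" if N: "N \<in> set us" for N
          proof -
            obtain \<delta> where \<delta>: "\<delta> \<noteq> 0" "\<forall>x. det2 (N (override_on x s D)) = \<delta>"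
              using us N unfolding good_def by blast
            have "det2 (N (\<theta> x)) = \<delta>" for x using \<delta>(2)[rule_format, of "\<theta> x"] by (simp add: \<theta>)
            with \<delta>(1) show ?thesis unfolding \<theta>_def by blast
          qed
          have "P (\<theta> x) = cross2 h (chain_apply us (\<theta> x) (vec_scale c g))" for x
          proof -
            have "cross2 h' (chain_apply vs (\<theta> x) w) = c" using c \<theta>(2)[of x] by (metis R_def)
            moreover have "M (\<theta> x) = M s'" using M\<tau>[of "\<theta> x"] by (simp add: \<theta>)
            ultimately show ?thesis using less.prems(4)[of "\<theta> x"] by (simp add: \<theta> ys gh)
          qed
          then show "row_sum 1 (override_on x s' (D \<union> Vs)) * row_sum 2 (override_on x s' (D \<union> Vs)) +
            row_sum 3 (override_on x s' (D \<union> Vs)) * row_sum 4 (override_on x s' (D \<union> Vs)) =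
            cross2 h (chain_apply us (override_on x s' (D \<union> Vs)) (vec_scale c g))" for x
            by (simp add: P_def \<theta>_def)
        qed (use s'(3) in blast)
      qed
    qed
  qed
  from this[of "[]" Ms "{}" _ h0] show False using eq by (simp add: P_def)
qed

section \<open>Evaluation in the algebraic closure\<close>

definition eval_mon :: "('v \<Rightarrow> 'k::field) \<Rightarrow> ('v \<Rightarrow>\<^sub>0 nat) \<Rightarrow> 'k" where
  "eval_mon x m = (\<Prod>v\<in>Poly_Mapping.keys m. x v ^ Poly_Mapping.lookup m v)"

text \<open>Evaluation is a ring homomorphism, so formal equality of polynomials gives equality at
  all points of the closure; the lower bound uses only this direction.\<close>

definition eval_ac :: "('v \<Rightarrow> 'a alg_closure) \<Rightarrow> ('v, 'a::field) mpoly \<Rightarrow> 'a alg_closure" where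
  "eval_ac x f = (\<Sum>m\<in>Poly_Mapping.keys f. to_ac (Poly_Mapping.lookup f m) * eval_mon x m)"

lemma eval_mon_superset:
  assumes "finite A" "Poly_Mapping.keys m \<subseteq> A"
  shows "eval_mon x m = (\<Prod>v\<in>A. x v ^ Poly_Mapping.lookup m v)"
  unfolding eval_mon_def
  by (rule prod.mono_neutral_left) (use assms in \<open>auto simp: in_keys_iff\<close>)

lemma eval_mon_add: "eval_mon x (m + n) = eval_mon x m * eval_mon x n"
proof -
  define A where "A = Poly_Mapping.keys m \<union> Poly_Mapping.keys n"
  have A: "finite A" "Poly_Mapping.keys m \<subseteq> A" "Poly_Mapping.keys n \<subseteq> A" "Poly_Mapping.keys (m + n) \<subseteq> A"
    using keys_add[of m n] by (auto simp: A_def)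
  show ?thesis
    by (simp add: eval_mon_superset[OF A(1)] A lookup_add power_add prod.distrib)
qed

lemma eval_ac_superset:
  assumes "finite A" "Poly_Mapping.keys f \<subseteq> A"
  shows "eval_ac x f = (\<Sum>m\<in>A. to_ac (Poly_Mapping.lookup f m) * eval_mon x m)"
  unfolding eval_ac_def
  by (rule sum.mono_neutral_left) (use assms in \<open>auto simp: in_keys_iff\<close>)

lemma eval_ac_0 [simp]: "eval_ac x 0 = 0"
  by (simp add: eval_ac_def)

lemma eval_ac_single: "eval_ac x (Poly_Mapping.single m c) = to_ac c * eval_mon x m"
  by (simp add: eval_ac_def)

lemma eval_ac_add [simp]: "eval_ac x (f + g) = eval_ac x f + eval_ac x g"
proof -
  define A where "A = Poly_Mapping.keys f \<union> Poly_Mapping.keys g"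
  have A: "finite A" "Poly_Mapping.keys f \<subseteq> A" "Poly_Mapping.keys g \<subseteq> A" "Poly_Mapping.keys (f + g) \<subseteq> A"
    using keys_add[of f g] by (auto simp: A_def)
  show ?thesis
    by (simp add: eval_ac_superset[OF A(1)] A lookup_add ring_distribs sum.distrib)
qed

lemma eval_ac_sum [simp]: "eval_ac x (\<Sum>i\<in>I. f i) = (\<Sum>i\<in>I. eval_ac x (f i))"
  by (induction I rule: infinite_finite_induct) simp_all

lemma sum_single_lookup:
  fixes f :: "'b \<Rightarrow>\<^sub>0 'c::comm_monoid_add"
  shows "f = (\<Sum>m\<in>Poly_Mapping.keys f. Poly_Mapping.single m (Poly_Mapping.lookup f m))"
proof (rule poly_mapping_eqI)
  fix k
  have "(\<Sum>m\<in>Poly_Mapping.keys f. Poly_Mapping.lookup (Poly_Mapping.single m (Poly_Mapping.lookup f m)) k) =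
    (\<Sum>m\<in>Poly_Mapping.keys f. if m = k then Poly_Mapping.lookup f k else 0)"
    by (intro sum.cong) (auto simp: lookup_single)
  then show "Poly_Mapping.lookup f k =
    Poly_Mapping.lookup (\<Sum>m\<in>Poly_Mapping.keys f. Poly_Mapping.single m (Poly_Mapping.lookup f m)) k"
    by (simp add: lookup_sum in_keys_iff)
qed

lemma eval_ac_mult [simp]: "eval_ac x (f * g) = eval_ac x f * eval_ac x g"
proof -
  have "f * g = (\<Sum>m\<in>Poly_Mapping.keys f. \<Sum>n\<in>Poly_Mapping.keys g.
      Poly_Mapping.single (m + n) (Poly_Mapping.lookup f m * Poly_Mapping.lookup g n))"
    by (subst sum_single_lookup[of f], subst sum_single_lookup[of g])
      (simp add: sum_product mult_single)
  then have "eval_ac x (f * g) = (\<Sum>m\<in>Poly_Mapping.keys f. \<Sum>n\<in>Poly_Mapping.keys g.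
      (to_ac (Poly_Mapping.lookup f m) * eval_mon x m) * (to_ac (Poly_Mapping.lookup g n) * eval_mon x n))"
    by (simp add: eval_ac_single eval_mon_add mult_ac)
  then show ?thesis by (simp add: eval_ac_def sum_product)
qed

lemma eval_ac_Const [simp]: "eval_ac x (Const c) = to_ac c"
  by (simp add: Const_def eval_ac_single eval_mon_def)

lemma eval_ac_1 [simp]: "eval_ac x 1 = 1"
  using eval_ac_Const[of x 1] by (simp add: Const_def)

lemma eval_ac_Var [simp]: "eval_ac x (Var v) = x v"
  by (simp add: Var_def eval_ac_single eval_mon_def)

lemma simple_fun_eval_ac:
  assumes "simple_affine_linear_form V f"
  shows "\<exists>Vs. simple_fun Vs (\<lambda>x. eval_ac x f)"
proof -
  obtain v \<alpha> \<beta> where f: "f = Const \<alpha> * Var v + Const \<beta>"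
    using assms unfolding simple_affine_linear_form_def by blast
  show ?thesis
  proof (cases "\<alpha> = 0")
    case True
    then show ?thesis by (intro exI[of _ "{}"]) (auto simp: simple_fun_def f)
  next
    case False
    then show ?thesis
      unfolding simple_fun_def f
      by (intro exI[of _ "{v}"] disjI2 exI[of _ v] exI[of _ "to_ac \<alpha>"] exI[of _ "to_ac \<beta>"]) simp
  qed
qed

section \<open>Branching programs\<close>

text \<open>The start vertex varies so that the value can be unfolded by the first edge of a
  path.\<close>

definition value_from :: "('n, 'v, 'a::field) abp \<Rightarrow> 'n \<Rightarrow> ('v, 'a) mpoly" where
  "value_from A u = (\<Sum>p | pre_digraph.apath (with_proj (graph A)) u p (sink A).
     prod_list (map (label A) p))"

lemma abp_value_eq: "abp_value A = value_from A (source A)"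
  by (simp add: abp_value_def value_from_def)

context
  fixes A :: "('n, 'v, 'a::field) abp"
  assumes A: "is_abp A"
begin

interpretation pair_fin_digraph "graph A"
  using A by (simp add: is_abp_def)

lemma layer_arc: "(u, v) \<in> parcs (graph A) \<Longrightarrow> layer A v = layer A u + 1"
  using A by (auto simp: is_abp_def)

lemma sink_vertex: "sink A \<in> pverts (graph A)"
  using A by (simp add: is_abp_def)

lemma layer_apath: "apath u p v \<Longrightarrow> layer A v = layer A u + int (length p)"
proof (induction p arbitrary: u)
  case Nil
  then show ?case by (simp add: apath_Nil_iff)
next
  case (Cons e p)
  then have "e \<in> parcs (graph A)" "fst e = u" "apath (snd e) p v" by (auto simp: apath_Cons_iff)
  with Cons.IH[of "snd e"] layer_arc[of u "snd e"] show ?case by (cases e) auto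
qed

lemma layer_apath_verts: "apath u p v \<Longrightarrow> x \<in> set (pawalk_verts u p) \<Longrightarrow> layer A u \<le> layer A x"
proof (induction p arbitrary: u)
  case Nil
  then show ?case by simp
next
  case (Cons e p)
  then have "e \<in> parcs (graph A)" "fst e = u" "apath (snd e) p v" by (auto simp: apath_Cons_iff)
  with Cons.IH[of "snd e"] Cons.prems(2) layer_arc[of u "snd e"] show ?case by (cases e) auto
qed

text \<open>Layers increase along edges, so a path cannot return to \<open>u\<close> and the
  freshness condition of \<open>apath_Cons_iff\<close> holds automatically.\<close>

lemma apath_Cons_layered:
  "apath u (e # p) v \<longleftrightarrow> e \<in> parcs (graph A) \<and> fst e = u \<and> apath (snd e) p v"
  using layer_apath_verts[of "snd e" p v "fst e"] layer_arc[of "fst e" "snd e"]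
  by (auto simp: apath_Cons_iff)

lemma value_from_sink: "value_from A (sink A) = 1"
proof -
  have "{p. apath (sink A) p (sink A)} = {[]}"
    using layer_apath[of "sink A" _ "sink A"] sink_vertex by (auto simp: apath_Nil_iff)
  then show ?thesis by (simp add: value_from_def)
qed

lemma value_from_no_path: "layer A (sink A) \<le> layer A u \<Longrightarrow> u \<noteq> sink A \<Longrightarrow> value_from A u = 0"
proof -
  assume u: "layer A (sink A) \<le> layer A u" "u \<noteq> sink A"
  have "\<not> apath u p (sink A)" for p
  proof
    assume p: "apath u p (sink A)"
    then have "p = []" using layer_apath[OF p] u(1) by simp
    with p u(2) show False by (simp add: apath_Nil_iff)
  qed
  then have "{p. apath u p (sink A)} = {}" by simp
  then show ?thesis by (simp add: value_from_def)
qed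

lemma value_from_non_vertex: "u \<notin> pverts (graph A) \<Longrightarrow> value_from A u = 0"
proof -
  assume "u \<notin> pverts (graph A)"
  then have "{p. apath u p (sink A)} = {}" by (auto simp: apath_def dest: awalk_hd_in_verts)
  then show ?thesis by (simp add: value_from_def)
qed

text \<open>A path to the sink is a first edge followed by a path from its head; \<open>u\<close>
  differs from the sink, which excludes the empty path.\<close>

lemma value_from_rec:
  assumes "u \<noteq> sink A"
  shows "value_from A u = (\<Sum>w | (u, w) \<in> parcs (graph A). label A (u, w) * value_from A w)"
proof -
  define P where "P w = {p. apath w p (sink A)}" for w
  define succs where "succs = {w. (u, w) \<in> parcs (graph A)}"
  have "succs \<subseteq> snd ` parcs (graph A)" by (force simp: succs_def)
  then have fin: "finite succs" by (rule finite_subset) (simp add: pair_finite_arcs)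
  have finP: "finite (P w)" for w unfolding P_def by (rule apaths_finite)
  have "P u = (\<lambda>(w, p). (u, w) # p) ` Sigma succs P"
  proof (rule Set.set_eqI)
    fix p
    show "p \<in> P u \<longleftrightarrow> p \<in> (\<lambda>(w, p). (u, w) # p) ` Sigma succs P"
      using assms by (cases p) (force simp: P_def succs_def apath_Nil_iff apath_Cons_layered image_iff)+
  qed
  moreover have "inj_on (\<lambda>(w, p). (u, w) # p) (Sigma succs P)" by (auto simp: inj_on_def)
  ultimately have "value_from A u = (\<Sum>(w, p)\<in>Sigma succs P. label A (u, w) * prod_list (map (label A) p))"
    by (simp add: value_from_def P_def[symmetric] sum.reindex case_prod_unfold)
  also have "\<dots> = (\<Sum>w\<in>succs. \<Sum>p\<in>P w. label A (u, w) * prod_list (map (label A) p))"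
    by (rule sum.Sigma[symmetric]) (use fin finP in auto)
  finally show ?thesis
    by (simp add: value_from_def P_def succs_def sum_distrib_left)
qed

end

section \<open>From weak branching programs of width two to chains of matrices\<close>

definition arc_label :: "('n, 'v, 'a::field) abp \<Rightarrow> 'n \<Rightarrow> 'n \<Rightarrow> ('v, 'a) mpoly" where
  "arc_label A u w = (if (u, w) \<in> parcs (graph A) then label A (u, w) else 0)"

text \<open>Layers with fewer than two vertices are padded with numbers that are not vertices.\<close>
lemma two_element_cover:
  fixes L U :: "nat set"
  assumes "finite U" "L \<subseteq> U" "card L \<le> 2"
  shows "\<exists>a b. a \<noteq> b \<and> {a, b} \<inter> U = L"
proof -
  obtain c where c: "c \<notin> U" using assms(1) ex_new_if_finite infinite_UNIV_nat by blast
  obtain d where d: "d \<notin> insert c U" using assms(1) ex_new_if_finite infinite_UNIV_nat by (metis finite_insert)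
  consider "L = {}" | x where "L = {x}" | x y where "L = {x, y}" "x \<noteq> y"
    using assms finite_subset[OF assms(2,1)]
    by (metis One_nat_def Suc_1 card_0_eq card_1_singletonE card_2_iff le_SucE le_zero_eq)
  then show ?thesis
  proof cases
    case 1
    with c d show ?thesis by (intro exI[of _ c] exI[of _ d]) auto
  next
    case (2 x)
    with c assms(2) show ?thesis by (intro exI[of _ x] exI[of _ c]) auto
  next
    case (3 x y)
    with assms(2) show ?thesis by (intro exI[of _ x] exI[of _ y]) auto
  qed
qed

text \<open>For the pair \<open>W i\<close> of values computed from the two vertices of layer
  \<open>i\<close>, the recursion over the first edge reads \<open>W i = N i * W (i + 1)\<close>.
  Missing edges give zero entries, and an edge is a pair of vertices, so each entry involves at most
  one variable.\<close>

lemma weak_abp_chain: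
  fixes A :: "(nat, 'v, 'a::field) abp"
  assumes weak: "weak_abp V A" and width: "abp_width A \<le> 2"
  shows "\<exists>Ms h w. (\<forall>M\<in>set Ms. \<exists>Vs. simple_layer Vs M) \<and>
    (\<forall>x. eval_ac x (abp_value A) = cross2 h (chain_apply Ms x w))"
proof -
  have A: "is_abp A" and lab: "\<And>e. e \<in> parcs (graph A) \<Longrightarrow> simple_affine_linear_form V (label A e)"
    using weak by (auto simp: weak_abp_def)
  interpret pair_fin_digraph "graph A" using A by (simp add: is_abp_def)
  define U where "U = pverts (graph A)"
  define L where "L i = {v \<in> U. layer A v = i}" for i
  have finU: "finite U" by (simp add: U_def pair_finite_verts)
  have "card (L i) \<le> 2" for i
  proof (cases "L i = {}")
    case False
    then have "i \<in> layer A ` U" by (auto simp: L_def)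
    then have "card (L i) \<le> abp_width A"
      unfolding abp_width_def L_def U_def[symmetric] using finU by (intro Max_ge) auto
    with width show ?thesis by simp
  qed simp
  then have "\<exists>a b. a \<noteq> b \<and> {a, b} \<inter> U = L i" for i
    by (intro two_element_cover finU) (auto simp: L_def)
  then obtain a b where ab: "\<And>i. a i \<noteq> b i" "\<And>i. {a i, b i} \<inter> U = L i" by metis
  define E where "E u w x = eval_ac x (arc_label A u w)" for u w x
  define N where "N i x = (E (a i) (a (i + 1)) x, E (a i) (b (i + 1)) x,
    E (b i) (a (i + 1)) x, E (b i) (b (i + 1)) x)" for i x
  define W where "W i x = (eval_ac x (value_from A (a i)), eval_ac x (value_from A (b i)))" for i x
  have E_simple: "\<exists>Vs. simple_fun Vs (E u w)" for u w
  proof (cases "(u, w) \<in> parcs (graph A)")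
    case True
    then show ?thesis using simple_fun_eval_ac[OF lab[OF True]] by (simp add: E_def[abs_def] arc_label_def)
  next
    case False
    then show ?thesis by (intro exI[of _ "{}"]) (auto simp: simple_fun_def E_def[abs_def] arc_label_def)
  qed
  have N_simple: "\<exists>Vs. simple_layer Vs (N i)" for i
  proof -
    from E_simple obtain Y where Y: "\<And>u w. simple_fun (Y u w) (E u w)" by metis
    show ?thesis
      unfolding simple_layer_def N_def[abs_def] by (intro exI conjI) (rule refl Y)+
  qed
  \<comment> \<open>Before the layer of the sink neither vertex is the sink, so the recursion
    applies; a padding vertex has no outgoing arcs and value zero.\<close>
  have step: "mat_vec (N i x) (W (i + 1) x) = W i x" if i: "i < layer A (sink A)" for i x
  proof -
    have "value_from A u = arc_label A u (a (i + 1)) * value_from A (a (i + 1)) +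
      arc_label A u (b (i + 1)) * value_from A (b (i + 1))" if u: "u \<in> {a i, b i}" for u
    proof -
      have "u \<noteq> sink A" using u i ab(2)[of i] sink_vertex[OF A] by (auto simp: L_def U_def)
      then have "value_from A u = (\<Sum>w | (u, w) \<in> parcs (graph A). arc_label A u w * value_from A w)"
        by (subst value_from_rec[OF A]) (simp_all add: arc_label_def)
      also have "\<dots> = (\<Sum>w\<in>{a (i + 1), b (i + 1)}. arc_label A u w * value_from A w)"
      proof (rule sum.mono_neutral_left)
        show "{w. (u, w) \<in> parcs (graph A)} \<subseteq> {a (i + 1), b (i + 1)}"
        proof
          fix w assume "w \<in> {w. (u, w) \<in> parcs (graph A)}"
          then have arc: "(u, w) \<in> parcs (graph A)" by simp
          then have uw: "u \<in> U" "w \<in> U" by (auto simp: U_def dest: in_arcsD1 in_arcsD2)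
          then have "layer A u = i" using u ab(2)[of i] by (auto simp: L_def)
          then have "w \<in> L (i + 1)" using uw layer_arc[OF A arc] by (simp add: L_def)
          then show "w \<in> {a (i + 1), b (i + 1)}" using ab(2)[of "i + 1"] by blast
        qed
      qed (auto simp: arc_label_def)
      finally show ?thesis using ab(1)[of "i + 1"] by simp
    qed
    then show ?thesis by (simp add: N_def W_def E_def)
  qed
  \<comment> \<open>Layers are arbitrary integers, so the induction counts the \<open>k\<close>
    steps back from the layer of the sink.\<close>
  have chain: "\<exists>Ms. (\<forall>M\<in>set Ms. \<exists>Vs. simple_layer Vs M) \<and>
    (\<forall>x. chain_apply Ms x (W (layer A (sink A)) x) = W (layer A (sink A) - int k) x)" for k
  proof (induction k)
    case 0
    show ?case by (intro exI[of _ "[]"]) simp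
  next
    case (Suc k)
    then obtain Ms where "\<forall>M\<in>set Ms. \<exists>Vs. simple_layer Vs M"
      "\<And>x. chain_apply Ms x (W (layer A (sink A)) x) = W (layer A (sink A) - int k) x" by blast
    with step[of "layer A (sink A) - int (Suc k)"] N_simple show ?case
      by (intro exI[of _ "N (layer A (sink A) - int (Suc k)) # Ms"]) simp
  qed
  show ?thesis
  proof (cases "layer A (source A) \<le> layer A (sink A)")
    case False
    then have "value_from A (source A) = 0" by (intro value_from_no_path[OF A]) auto
    then show ?thesis by (intro exI[of _ "[]"] exI[of _ "(0, 0)"]) (simp add: abp_value_eq cross2_def)
  next
    case True
    define k where "k = nat (layer A (sink A) - layer A (source A))"
    define t where "t = layer A (sink A)"
    have k: "t - int k = layer A (source A)" using True by (simp add: k_def t_def)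
    obtain Ms where Ms: "\<forall>M\<in>set Ms. \<exists>Vs. simple_layer Vs M"
      "\<And>x. chain_apply Ms x (W t x) = W (layer A (source A)) x" using chain[of k] k by (auto simp: t_def)
    \<comment> \<open>In its own layer only the sink has a path to the sink, the empty one, so the
      last vector is constant.\<close>
    have "eval_ac x (value_from A u) = (if u = sink A then 1 else 0)" if "u \<in> {a t, b t}" for u x
    proof (cases "u \<in> U")
      case True
      then have "layer A u = t" using that ab(2)[of t] by (auto simp: L_def)
      then show ?thesis
        by (simp add: value_from_sink[OF A] value_from_no_path[OF A] t_def)
    next
      case False
      then have "u \<noteq> sink A" using sink_vertex[OF A] by (auto simp: U_def)
      then show ?thesis using False by (simp add: value_from_non_vertex[OF A] U_def)
    qed
    then have Wt: "W t x = (if a t = sink A then 1 else 0, if b t = sink A then 1 else 0)" for x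
      by (simp add: W_def)
    have "source A \<in> L (layer A (source A))" using A by (simp add: L_def U_def is_abp_def)
    then have "source A \<in> {a (layer A (source A)), b (layer A (source A))}"
      using ab(2) by blast
    then consider "source A = a (layer A (source A))" | "source A = b (layer A (source A))" by blast
    then have "\<exists>h. \<forall>x. eval_ac x (abp_value A) = cross2 h (W (layer A (source A)) x)"
    proof cases
      case 1
      \<comment> \<open>As functionals, \<open>cross2 (0, - 1)\<close> selects the first coordinate
        and \<open>cross2 (1, 0)\<close> the second.\<close>
      then show ?thesis by (intro exI[of _ "(0, - 1)"]) (simp add: cross2_def W_def abp_value_eq)
    next
      case 2
      then show ?thesis by (intro exI[of _ "(1, 0)"]) (simp add: cross2_def W_def abp_value_eq)
    qed
    then show ?thesis using Ms(1) unfolding Ms(2)[symmetric] Wt by blast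
  qed
qed

section \<open>The general branching program for the upper bound\<close>

definition row_form :: "nat \<Rightarrow> (nat \<times> nat, 'a::field) mpoly" where
  "row_form i = (\<Sum>j=1..7. Var (i, j))"

lemma affine_row_form:
  assumes "i \<in> {1..4}"
  shows "affine_linear_form x_vars (row_form i :: (nat \<times> nat, 'a::field) mpoly)"
proof -
  have "(\<Sum>v\<in>x_vars. Const (if fst v = i then 1 else 0) * Var v :: (nat \<times> nat, 'a) mpoly) =
    (\<Sum>i'=1..4. \<Sum>j=1..7. if i' = i then Var (i, j) else 0)"
    unfolding x_vars_def sum.cartesian_product
    by (intro sum.cong) (auto simp: Const_def)
  also have "\<dots> = (\<Sum>i'=1..4. if i' = i then row_form i else 0)"
    by (intro sum.cong) (auto simp: row_form_def)
  also have "\<dots> = row_form i" using assms by (simp add: sum.delta)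
  finally show ?thesis
    unfolding affine_linear_form_def
    by (intro exI[of _ "\<lambda>v. if fst v = i then 1 else 0"] exI[of _ 0]) (simp add: Const_def)
qed

text \<open>The two paths, through \<open>1\<close> and through \<open>2\<close>, carry the two
  products of \<open>p_poly\<close>.\<close>

definition diamond :: "(nat, nat \<times> nat, 'a::field) abp" where
  "diamond = \<lparr>graph = \<lparr>pverts = {0, 1, 2, 3}, parcs = {(0, 1), (1, 3), (0, 2), (2, 3)}\<rparr>,
     layer = (\<lambda>v. if v = 0 then 0 else if v = 3 then 2 else 1),
     label = (\<lambda>e. row_form (if e = (0, 1) then 1 else if e = (1, 3) then 2 else if e = (0, 2) then 3 else 4)),
     source = 0, sink = 3\<rparr>"

lemma is_abp_diamond: "is_abp (diamond :: (nat, nat \<times> nat, 'a::field) abp)"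
proof -
  let ?E = "{(0, 1), (1, 3), (0, 2), (2, 3)} :: (nat \<times> nat) set"
  have "(x, y) \<in> ?E\<^sup>+ \<Longrightarrow> x < y" for x y
    by (induction rule: trancl_induct) auto
  then have "acyclic ?E" by (auto simp: acyclic_def)
  moreover have "pair_fin_digraph (graph (diamond :: (nat, nat \<times> nat, 'a) abp))"
    by unfold_locales (auto simp: diamond_def)
  ultimately show ?thesis by (auto simp: is_abp_def diamond_def)
qed

lemma width_diamond: "abp_width (diamond :: (nat, nat \<times> nat, 'a::field) abp) = 2"
proof -
  let ?l = "\<lambda>v::nat. if v = 0 then 0 else if v = 3 then 2 else (1::int)"
  have "{v \<in> {0, 1, 2, 3::nat}. ?l v = 0} = {0}" "{v \<in> {0, 1, 2, 3::nat}. ?l v = 1} = {1, 2}"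
    "{v \<in> {0, 1, 2, 3::nat}. ?l v = 2} = {3}" by auto
  then have "(\<lambda>i. card {v \<in> {0, 1, 2, 3::nat}. ?l v = i}) ` ?l ` {0, 1, 2, 3} = {Suc (Suc 0), 1}"
    by simp
  then show ?thesis by (simp add: abp_width_def diamond_def)
qed

lemma value_diamond: "abp_value diamond = (p_poly :: (nat \<times> nat, 'a::field) mpoly)"
proof -
  define D :: "(nat, nat \<times> nat, 'a) abp" where "D = diamond"
  have A: "is_abp D" unfolding D_def by (rule is_abp_diamond)
  have s: "source D = 0" "sink D = 3" by (simp_all add: D_def diamond_def)
  have succ: "{w. (0, w) \<in> parcs (graph D)} = {1, 2}" "{w. (1, w) \<in> parcs (graph D)} = {3}"
    "{w. (2, w) \<in> parcs (graph D)} = {3}"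
    by (auto simp: D_def diamond_def)
  have lab: "label D (0, 1) = row_form 1" "label D (1, 3) = row_form 2"
    "label D (0, 2) = row_form 3" "label D (2, 3) = row_form 4"
    by (simp_all add: D_def diamond_def)
  have "value_from D 3 = 1" using value_from_sink[OF A] by (simp add: s)
  then have "value_from D 1 = row_form 2" "value_from D 2 = row_form 4"
    using value_from_rec[OF A, of 1] value_from_rec[OF A, of 2] unfolding succ s
    by (simp_all add: lab del: One_nat_def)
  then have "value_from D 0 = row_form 1 * row_form 2 + row_form 3 * row_form 4"
    using value_from_rec[OF A, of 0] unfolding succ s
    by (simp add: lab del: One_nat_def)
  then show ?thesis by (simp add: abp_value_eq s p_poly_def row_form_def flip: D_def)
qed

theorem theorem5p4:
  shows "computable_general_abp x_vars 2 (p_poly :: (nat \<times> nat, 'a::field) mpoly)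
       \<and> \<not> computable_weak_abp x_vars 2 (p_poly :: (nat \<times> nat, 'a) mpoly)"
proof
  have "general_abp x_vars (diamond :: (nat, nat \<times> nat, 'a) abp)"
    using is_abp_diamond
    by (auto simp: general_abp_def diamond_def intro!: affine_row_form)
  then show "computable_general_abp x_vars 2 (p_poly :: (nat \<times> nat, 'a) mpoly)"
    unfolding computable_general_abp_def using width_diamond value_diamond by blast
  show "\<not> computable_weak_abp x_vars 2 (p_poly :: (nat \<times> nat, 'a) mpoly)"
  proof
    assume "computable_weak_abp x_vars 2 (p_poly :: (nat \<times> nat, 'a) mpoly)"
    then obtain A :: "(nat, nat \<times> nat, 'a) abp"
      where A: "weak_abp x_vars A" "abp_width A = 2" and val: "abp_value A = p_poly"
      unfolding computable_weak_abp_def by blast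
    have "abp_width A \<le> 2" using A(2) by simp
    from weak_abp_chain[OF A(1) this] obtain Ms h w where Ms: "\<forall>M\<in>set Ms. \<exists>Vs. simple_layer Vs M"
      and eq: "\<forall>x. eval_ac x (abp_value A) = cross2 h (chain_apply Ms x w)"
      by blast
    show False
    proof (rule p_not_simple_chain)
      show "row_sum 1 x * row_sum 2 x + row_sum 3 x * row_sum 4 x = cross2 h (chain_apply Ms x w)" for x
        using eq[rule_format, of x] by (simp add: val p_poly_def row_sum_def)
    qed (use Ms in blast)
  qed
qed

end
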